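(* Let $S,\delta,c,d,\lambda>0$ and $\mu>\lambda$ be constants, and let $D=[0,1]$. Consider the single-regime controlled dynamics, the admissible controls $\mathcal{C}$, the performance index $\phi(x,\bar\eta)$ and the value function $\Phi(x)=\inf_{\bar\eta\in\mathcal{C}}\phi(x,\bar\eta)$ defined in the context. Put $$\alpha=\frac{\mu}{\delta+\mu}\Big(c+d+\frac{cS}{\delta+\mu}\Big),\quad \beta=\frac{\mu}{\delta+\mu},\quad \gamma=\frac{1}{\delta+\mu}-\frac{\mu cS}{(\delta+\mu)^2},$$ and, for $K\in\mathbb{R}$, $$A(K)=\frac{\lambda\alpha}{\delta+\lambda}+\frac{\lambda cS\beta}{(\delta+\lambda)^2}+\frac{\lambda\beta K}{\delta+\lambda},\quad B=-\frac{\lambda c\beta}{\delta+\lambda},\quad C=-\frac{\lambda}{\mu-\lambda}\gamma,\quad G=\frac{1}{\delta+\lambda}\Big(1-\frac{\lambda cS\beta}{\delta+\lambda}+\frac{\lambda(\delta+\mu)\gamma}{\mu-\lambda}\Big).$$ Assume that the system of two algebraic equations $$G e^{-\frac{\delta+\lambda}{S}\bar{x}}+A(K)+B\bar{x}+C e^{-\frac{\delta+\mu}{S}\bar{x}}=K e^{\frac{\delta}{S}(1-\bar{x})},$$ $$-\frac{\delta+\lambda}{S}G e^{-\frac{\delta+\lambda}{S}\bar{x}}+B-\frac{\delta+\mu}{S}C e^{-\frac{\delta+\mu}{S}\bar{x}}=-\frac{\delta}{S}K e^{\frac{\delta}{S}(1-\bar{x})}$$ has a unique solution $(K,\bar{x})\in\mathbb{R}\times(0,1)$,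 and with this solution define $$\bar\Phi(x)=\begin{cases}G e^{-\frac{\delta+\lambda}{S}x}+A(K)+Bx+C e^{-\frac{\delta+\mu}{S}x} & (0\le x\le\bar{x}),\\ K e^{\frac{\delta}{S}(1-x)} & (\bar{x}<x\le 1),\end{cases}$$ so that $K=\bar\Phi(1)$. Then $\Phi(x)\ge\bar\Phi(x)$ for all $x\in D$. Furthermore, the threshold control given, for each $k\ge1$, by $$\eta_k^*=\begin{cases}1-X_{\tau_k+\omega_k} & (0\le X_{\tau_k}\le\bar{x}),\\ 0 & (\bar{x}<X_{\tau_k}\le1)\end{cases}$$ (that is, $\theta_k=1$ if and only if $X_{\tau_k}\le\bar{x}$) is a minimizer of $\phi(x,\cdot)$ over $\mathcal{C}$, and it gives $\Phi(x)=\bar\Phi(x)$ for all $x\in D$.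
   Context: Notation: $\chi_E$ is the indicator of $E$; $\mathrm{Exp}_p$ is the exponential distribution with rate $p$. Observation and intervention times. Let $W_1,W_2,\dots\sim\mathrm{Exp}_\lambda$ (waiting times) and $\omega_1,\omega_2,\dots\sim\mathrm{Exp}_\mu$ (execution delays) be mutually independent. Set $\tau_0=0$, $\theta_0=0$. At each observation time $\tau_k$ ($k\ge1$) the decision-maker chooses $\theta_k\in\{0,1\}$ ($\theta_k=0$: do nothing; $\theta_k=1$: replenish). Put $\Delta_k=0$ if $\theta_k=0$ and $\Delta_k=\omega_k$ if $\theta_k=1$ (so $\Delta_0=0$), and $\tau_{k+1}=\tau_k+\Delta_k+W_{k+1}$. Dynamics. The state $X_t\in D=[0,1]$ starts at $X_0=x$ and satisfies $dX_t=-S\chi_{\{X_t>0\}}\,dt$ for $t>0$, $t\ne\tau_k+\Delta_k$ ($k\ge1$); between these times it decreases at speed $S$ until it reaches $0$ and then stays at $0$. At $t=\tau_k+\Delta_k$ ($k\ge1$), $X_{t+}=1$ if $\theta_k=1$ and $X_{t+}=X_t$ if $\theta_k=0$ ($X$ is left-continuous at these times). The amount of replenishment is $\eta_k=1-X_{\tau_k+\Delta_k}$ if $\theta_k=1$ and $\eta_k=0$ if $\theta_k=0$. Admissible controls. $\mathcal{C}$ is the set of processes $\bar\eta=(\bar\eta_t)_{t\ge0}$ equal to $\eta_k$ at each time $\tau_k+\Delta_k$ and equal to $0$ otherwise, where the decision $\theta_k$ at time $\tau_k$ is based only on the information available at $\tau_k$, i.e. $\theta_k$ is measurable with respect to the $\sigma$-algebra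 generated by $(\tau_j,X_{\tau_j})_{0\le j\le k}$ and $(\tau_j+\Delta_j,X_{\tau_j+\Delta_j})_{0\le j\le k-1}$. Performance index. With $\mathbb{E}^x$ the expectation conditioned on $X_0=x$, $$\phi(x,\bar\eta)=\mathbb{E}^x\left[\int_0^\infty e^{-\delta s}\chi_{\{X_s=0\}}\,ds+\sum_{k\ge1}e^{-\delta(\tau_k+\Delta_k)}\big(c\,\eta_k+d\,\chi_{\{\eta_k>0\}}\big)\right].$$ *)

theory Defs
  imports "HOL-Probability.Probability"
begin

text \<open>
  Pathwise quantities. The arguments \<open>W\<close>, \<open>om\<close> and \<open>\<theta>\<close> are one realisation of the waiting times, the
  execution delays and the decisions (\<open>\<theta> k\<close> means ``replenish at the \<open>k\<close>-th observation''). Index 0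
  of \<open>W\<close> and \<open>om\<close> is never used, and admissible controls satisfy \<open>\<not> \<theta> 0\<close>.
\<close>

definition exec_delay :: "(nat \<Rightarrow> real) \<Rightarrow> (nat \<Rightarrow> bool) \<Rightarrow> nat \<Rightarrow> real" where
  "exec_delay om \<theta> k = (if \<theta> k then om k else 0)"

primrec obs_time :: "(nat \<Rightarrow> real) \<Rightarrow> (nat \<Rightarrow> real) \<Rightarrow> (nat \<Rightarrow> bool) \<Rightarrow> nat \<Rightarrow> real" where
  "obs_time W om \<theta> 0 = 0"
| "obs_time W om \<theta> (Suc k) = obs_time W om \<theta> k + exec_delay om \<theta> k + W (Suc k)"

definition exec_time :: "(nat \<Rightarrow> real) \<Rightarrow> (nat \<Rightarrow> real) \<Rightarrow> (nat \<Rightarrow> bool) \<Rightarrow> nat \<Rightarrow> real" where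
  "exec_time W om \<theta> k = obs_time W om \<theta> k + exec_delay om \<theta> k"

text \<open>
  The solution at elapsed time \<open>t\<close> of \<open>dX = -S \<chi>{X > 0} dt\<close> started at \<open>y\<close>; see \<open>deplete_dynamics\<close>.
\<close>

definition deplete :: "real \<Rightarrow> real \<Rightarrow> real \<Rightarrow> real" where
  "deplete S y t = max 0 (y - S * t)"

text \<open>
  \<open>post_state k\<close>, \<open>obs_state k\<close> and \<open>pre_state k\<close> are the state just after \<open>exec_time k\<close>, at
  \<open>obs_time k\<close>, and at \<open>exec_time k\<close> (left limit). They are given by recursion on \<open>k\<close>, so that they
  are meaningful on every path, including the null set where some waiting time or delay is not
  positive. On all other paths they are the values of the process \<open>state\<close> below at these times; see
  \<open>state_obs_time\<close> and \<open>state_exec_time\<close>.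
\<close>

primrec post_state ::
    "real \<Rightarrow> real \<Rightarrow> (nat \<Rightarrow> real) \<Rightarrow> (nat \<Rightarrow> real) \<Rightarrow> (nat \<Rightarrow> bool) \<Rightarrow> nat \<Rightarrow> real" where
  "post_state S x W om \<theta> 0 = x"
| "post_state S x W om \<theta> (Suc k) =
     (if \<theta> (Suc k) then 1
      else deplete S (post_state S x W om \<theta> k) (W (Suc k) + exec_delay om \<theta> (Suc k)))"

definition obs_state ::
    "real \<Rightarrow> real \<Rightarrow> (nat \<Rightarrow> real) \<Rightarrow> (nat \<Rightarrow> real) \<Rightarrow> (nat \<Rightarrow> bool) \<Rightarrow> nat \<Rightarrow> real" where
  "obs_state S x W om \<theta> k =
     (case k of 0 \<Rightarrow> x | Suc j \<Rightarrow> deplete S (post_state S x W om \<theta> j) (W k))"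

definition pre_state ::
    "real \<Rightarrow> real \<Rightarrow> (nat \<Rightarrow> real) \<Rightarrow> (nat \<Rightarrow> real) \<Rightarrow> (nat \<Rightarrow> bool) \<Rightarrow> nat \<Rightarrow> real" where
  "pre_state S x W om \<theta> k =
     (case k of 0 \<Rightarrow> x
      | Suc j \<Rightarrow> deplete S (post_state S x W om \<theta> j) (W k + exec_delay om \<theta> k))"

text \<open>The left-continuous state process; \<open>k\<close> is the index with \<open>exec_time k < t \<le> exec_time (Suc k)\<close>.\<close>

definition state ::
    "real \<Rightarrow> real \<Rightarrow> (nat \<Rightarrow> real) \<Rightarrow> (nat \<Rightarrow> real) \<Rightarrow> (nat \<Rightarrow> bool) \<Rightarrow> real \<Rightarrow> real" where
  "state S x W om \<theta> t =
     (let k = (LEAST k. t \<le> exec_time W om \<theta> (Suc k))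
      in deplete S (post_state S x W om \<theta> k) (t - exec_time W om \<theta> k))"

definition replenishment ::
    "real \<Rightarrow> real \<Rightarrow> (nat \<Rightarrow> real) \<Rightarrow> (nat \<Rightarrow> real) \<Rightarrow> (nat \<Rightarrow> bool) \<Rightarrow> nat \<Rightarrow> real" where
  "replenishment S x W om \<theta> k = (if \<theta> k then 1 - pre_state S x W om \<theta> k else 0)"

definition path_cost ::
    "real \<Rightarrow> real \<Rightarrow> real \<Rightarrow> real \<Rightarrow> real \<Rightarrow> (nat \<Rightarrow> real) \<Rightarrow> (nat \<Rightarrow> real) \<Rightarrow> (nat \<Rightarrow> bool) \<Rightarrow> ennreal" where
  "path_cost S \<delta> c d x W om \<theta> =
     (\<integral>\<^sup>+ s. ennreal (exp (- \<delta> * s)) * indicator {s. 0 \<le> s \<and> state S x W om \<theta> s = 0} s \<partial>lborel)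
     + (\<Sum>k. ennreal (exp (- \<delta> * exec_time W om \<theta> (Suc k))
              * (c * replenishment S x W om \<theta> (Suc k)
                 + d * (if replenishment S x W om \<theta> (Suc k) > 0 then 1 else 0))))"


text \<open>The random model. The initial state is the deterministic parameter \<open>x\<close>.\<close>

definition exponential_times ::
    "'w measure \<Rightarrow> real \<Rightarrow> real \<Rightarrow> (nat \<Rightarrow> 'w \<Rightarrow> real) \<Rightarrow> (nat \<Rightarrow> 'w \<Rightarrow> real) \<Rightarrow> bool" where
  "exponential_times M lam mu W om \<longleftrightarrow>
     prob_space M
     \<and> (\<forall>k\<ge>1. distributed M lborel (W k) (exponential_density lam))
     \<and> (\<forall>k\<ge>1. distributed M lborel (om k) (exponential_density mu))
     \<and> prob_space.indep_vars M (\<lambda>_. borel) (case_sum W om) ({1..} <+> {1..})"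

definition info ::
    "'w measure \<Rightarrow> real \<Rightarrow> (nat \<Rightarrow> 'w \<Rightarrow> real) \<Rightarrow> (nat \<Rightarrow> 'w \<Rightarrow> real) \<Rightarrow> real
     \<Rightarrow> (nat \<Rightarrow> 'w \<Rightarrow> bool) \<Rightarrow> nat \<Rightarrow> 'w measure" where
  "info M S W om x \<theta> k =
     (let obs = (\<lambda>j w. (obs_time (\<lambda>i. W i w) (\<lambda>i. om i w) (\<lambda>i. \<theta> i w) j,
                        obs_state S x (\<lambda>i. W i w) (\<lambda>i. om i w) (\<lambda>i. \<theta> i w) j));
          exe = (\<lambda>j w. (exec_time (\<lambda>i. W i w) (\<lambda>i. om i w) (\<lambda>i. \<theta> i w) j,
                        pre_state S x (\<lambda>i. W i w) (\<lambda>i. om i w) (\<lambda>i. \<theta> i w) j))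
      in sigma (space M)
           ((\<Union>j\<in>{..k}. {obs j -` E \<inter> space M | E. E \<in> sets borel})
            \<union> (\<Union>j\<in>{..<k}. {exe j -` E \<inter> space M | E. E \<in> sets borel})))"

text \<open>A control is represented by its decision sequence, which determines the amounts \<open>replenishment\<close>.\<close>

definition admissible ::
    "'w measure \<Rightarrow> real \<Rightarrow> (nat \<Rightarrow> 'w \<Rightarrow> real) \<Rightarrow> (nat \<Rightarrow> 'w \<Rightarrow> real) \<Rightarrow> real
     \<Rightarrow> (nat \<Rightarrow> 'w \<Rightarrow> bool) set" where
  "admissible M S W om x =
     {\<theta>. (\<forall>w\<in>space M. \<not> \<theta> 0 w)
         \<and> (\<forall>k\<ge>1. \<theta> k \<in> info M S W om x \<theta> k \<rightarrow>\<^sub>M count_space UNIV)}"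

text \<open>
  All costs are nonnegative, so the expectation always exists in \<open>[0, \<infinity>]\<close>; it is viewed as an
  extended real so that it can be compared with real numbers of either sign.
\<close>

definition performance ::
    "'w measure \<Rightarrow> real \<Rightarrow> real \<Rightarrow> real \<Rightarrow> real \<Rightarrow> (nat \<Rightarrow> 'w \<Rightarrow> real) \<Rightarrow> (nat \<Rightarrow> 'w \<Rightarrow> real)
     \<Rightarrow> real \<Rightarrow> (nat \<Rightarrow> 'w \<Rightarrow> bool) \<Rightarrow> ereal" where
  "performance M S \<delta> c d W om x \<theta> =
     enn2ereal (\<integral>\<^sup>+ w. path_cost S \<delta> c d x (\<lambda>i. W i w) (\<lambda>i. om i w) (\<lambda>i. \<theta> i w) \<partial>M)"

definition value_function ::
    "'w measure \<Rightarrow> real \<Rightarrow> real \<Rightarrow> real \<Rightarrow> real \<Rightarrow> (nat \<Rightarrow> 'w \<Rightarrow> real) \<Rightarrow> (nat \<Rightarrow> 'w \<Rightarrow> real)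
     \<Rightarrow> real \<Rightarrow> ereal" where
  "value_function M S \<delta> c d W om x =
     (INF \<theta>\<in>admissible M S W om x. performance M S \<delta> c d W om x \<theta>)"

text \<open>
  This determines \<open>\<theta>\<close> uniquely on \<open>space M\<close>, since \<open>obs_state k\<close> depends on \<open>\<theta> 0, \<dots>, \<theta> (k - 1)\<close> only.
\<close>

definition threshold_control ::
    "'w measure \<Rightarrow> real \<Rightarrow> (nat \<Rightarrow> 'w \<Rightarrow> real) \<Rightarrow> (nat \<Rightarrow> 'w \<Rightarrow> real) \<Rightarrow> real \<Rightarrow> real
     \<Rightarrow> (nat \<Rightarrow> 'w \<Rightarrow> bool) \<Rightarrow> bool" where
  "threshold_control M S W om xbar x \<theta> \<longleftrightarrow>
     (\<forall>w\<in>space M. \<not> \<theta> 0 w \<and>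
        (\<forall>k\<ge>1. \<theta> k w \<longleftrightarrow> obs_state S x (\<lambda>i. W i w) (\<lambda>i. om i w) (\<lambda>i. \<theta> i w) k \<le> xbar))"


text \<open>Consistency of the pathwise definitions with the dynamics.\<close>

lemma deplete_dynamics:
  assumes "0 < S" "0 \<le> y" "0 \<le> t"
  shows "((\<lambda>s. - S * (if deplete S y s > 0 then 1 else 0)) has_integral (deplete S y t - y)) {0..t}"
proof -
  have "((\<lambda>s. - S * (if deplete S y s > 0 then 1 else 0)) has_integral
          (deplete S y t - deplete S y 0)) {0..t}"
  proof (rule fundamental_theorem_of_calculus_interior_strong[of "{y / S}"])
    show "continuous_on {0..t} (deplete S y)"
      unfolding deplete_def by (intro continuous_intros)
    fix s assume "s \<in> {0<..<t} - {y / S}"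
    then consider "s < y / S" | "s > y / S" by fastforce
    then have "(deplete S y has_real_derivative (- S * (if deplete S y s > 0 then 1 else 0))) (at s)"
    proof cases
      case 1
      have "((\<lambda>s. y - S * s) has_real_derivative - S) (at s)"
        by (auto intro!: derivative_eq_intros)
      then have "(deplete S y has_real_derivative - S) (at s)"
        by (rule has_field_derivative_transform_within_open[of _ _ _ "{..<y / S}"])
           (use 1 assms in \<open>auto simp: deplete_def field_simps max_def\<close>)
      moreover have "deplete S y s > 0"
        using 1 assms by (auto simp: deplete_def field_simps)
      ultimately show ?thesis by simp
    next
      case 2
      have "((\<lambda>s. 0) has_real_derivative 0) (at s)" by simp
      then have "(deplete S y has_real_derivative 0) (at s)"
        by (rule has_field_derivative_transform_within_open[of _ _ _ "{y / S<..}"])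
           (use 2 assms in \<open>auto simp: deplete_def field_simps max_def\<close>)
      moreover have "\<not> deplete S y s > 0"
        using 2 assms by (auto simp: deplete_def field_simps)
      ultimately show ?thesis by simp
    qed
    then show "(deplete S y has_vector_derivative (- S * (if deplete S y s > 0 then 1 else 0))) (at s)"
      by (simp only: has_real_derivative_iff_has_vector_derivative)
  qed (use assms in auto)
  then show ?thesis using assms by (simp add: deplete_def)
qed

context
  fixes W om :: "nat \<Rightarrow> real" and \<theta> :: "nat \<Rightarrow> bool"
  assumes positive: "\<And>k. k \<ge> 1 \<Longrightarrow> W k > 0" "\<And>k. k \<ge> 1 \<Longrightarrow> om k > 0" and "\<not> \<theta> 0"
begin

lemma exec_time_0: "exec_time W om \<theta> 0 = 0"
  using \<open>\<not> \<theta> 0\<close> by (simp add: exec_time_def exec_delay_def)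

lemma exec_time_Suc:
  "exec_time W om \<theta> (Suc k) = exec_time W om \<theta> k + W (Suc k) + exec_delay om \<theta> (Suc k)"
  by (simp add: exec_time_def)

lemma strict_mono_exec_time: "strict_mono (exec_time W om \<theta>)"
  using positive
  by (intro strict_monoI_Suc) (auto simp: exec_time_Suc exec_delay_def add_pos_pos)

lemma state_between:
  assumes "exec_time W om \<theta> k < t" "t \<le> exec_time W om \<theta> (Suc k)"
  shows "state S x W om \<theta> t = deplete S (post_state S x W om \<theta> k) (t - exec_time W om \<theta> k)"
proof -
  have "(LEAST k. t \<le> exec_time W om \<theta> (Suc k)) = k"
  proof (rule Least_equality)
    fix j assume "t \<le> exec_time W om \<theta> (Suc j)"
    with assms have "exec_time W om \<theta> k < exec_time W om \<theta> (Suc j)" by linarith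
    then show "k \<le> j" using strict_mono_exec_time by (auto simp: strict_mono_less)
  qed fact
  then show ?thesis by (simp add: state_def)
qed

lemma state_0:
  assumes "0 \<le> x" shows "state S x W om \<theta> 0 = x"
proof -
  have "0 \<le> exec_time W om \<theta> (Suc 0)"
    using strict_mono_exec_time exec_time_0 by (metis less_imp_le strict_mono_Suc_iff)
  then have "(LEAST k. 0 \<le> exec_time W om \<theta> (Suc k)) = 0"
    by (intro Least_equality) auto
  then show ?thesis using assms exec_time_0 by (simp add: state_def deplete_def)
qed

lemma state_obs_time:
  assumes "0 \<le> x" shows "state S x W om \<theta> (obs_time W om \<theta> k) = obs_state S x W om \<theta> k"
proof (cases k)
  case 0
  then show ?thesis using assms by (simp add: state_0 obs_state_def)
next
  case (Suc j)
  have "exec_time W om \<theta> j < obs_time W om \<theta> k" "obs_time W om \<theta> k \<le> exec_time W om \<theta> (Suc j)"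
    using positive Suc by (auto simp: exec_time_def exec_delay_def less_imp_le)
  from state_between[OF this] show ?thesis
    using Suc by (simp add: obs_state_def exec_time_def)
qed

lemma state_exec_time:
  assumes "0 \<le> x" shows "state S x W om \<theta> (exec_time W om \<theta> k) = pre_state S x W om \<theta> k"
proof (cases k)
  case 0
  then show ?thesis using assms by (simp add: state_0 exec_time_0 pre_state_def)
next
  case (Suc j)
  have "exec_time W om \<theta> j < exec_time W om \<theta> k"
    using strict_mono_exec_time Suc by (simp add: strict_mono_Suc_iff)
  from state_between[OF this] show ?thesis
    using Suc by (simp add: pre_state_def exec_time_Suc)
qed

end

end

theory Submission
  imports Defs
begin

text \<open>
  Between an execution time and the next observation nothing can be decided, so the problem is a
  discrete-time one: a cycle begins with the state \<open>y\<close> just after an execution time, lasts an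
  exponential waiting time \<open>w\<close>, and reaches an observed state \<open>z\<close> at which the decision is taken. If
  \<open>\<Phi>\<close> is the candidate value function, replenishing from \<open>z\<close> costs
  \<open>r(z) = \<alpha> + \<beta> K - c \<beta> z + \<gamma> e\<^bsup>-(\<delta>+\<mu>)z/S\<^esup>\<close> in expectation (with \<open>\<Phi>(1) = K\<close> as the
  cost afterwards), while waiting costs \<open>\<Phi>(z)\<close>. The dynamic programming equation is
  \<open>\<Phi>(y) = E[idle cost during w + e\<^bsup>-\<delta>w\<^esup> min (\<Phi>(z)) (r(z))]\<close>.

  \<^bold>\<open>The candidate solves it.\<close> Differentiating along the deterministic depletion turns the expectation
  over an exponential time of rate \<open>p\<close> into the linear equation \<open>S v' + (\<delta> + p) v = p m\<close> with one
  boundary condition at \<open>0\<close> (\<open>nn_integral_exponential_wait\<close>); \<open>r\<close> satisfies it for \<open>p = \<mu>\<close>. Below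
  \<open>xbar\<close> the candidate is the solution for \<open>p = \<lambda>\<close> and \<open>m = r\<close>, above it the solution for
  \<open>m = \<Phi>\<close>, and the two assumed algebraic equations say that the pieces fit together with a
  continuous derivative, hence also that \<open>r = \<Phi>\<close> at \<open>xbar\<close>.

  What remains is that waiting is the better choice exactly above \<open>xbar\<close>, that is, \<open>r \<le> \<Phi>\<close> on
  \<open>[0, xbar]\<close> and \<open>\<Phi> \<le> r\<close> on \<open>[xbar, 1]\<close>. The gap \<open>u = r - \<Phi>\<close> solves \<open>S u' + (\<delta> + \<lambda>) u = h\<close> below
  \<open>xbar\<close> and \<open>S u' + \<delta> u = h\<close> above it, with the same explicit source \<open>h = S r' + \<delta> r\<close>. This source
  is quasiconcave, \<open>u(0)\<close> is a positive multiple of \<open>h(0)\<close>, and \<open>h(1) = \<mu> (d - u(1))\<close>, so that a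
  nonpositive \<open>h(1)\<close> forces \<open>u(1) > 0\<close>. A sign discussion based on these three facts and
  \<open>u(xbar) = 0\<close> (\<open>single_crossing\<close>) shows that the zero of \<open>u\<close> at \<open>xbar\<close> is a crossing from below. As by-products
  \<open>\<gamma> \<ge> 0\<close>, \<open>K \<ge> 0\<close>, and both \<open>r\<close> and \<open>\<Phi>\<close> are nonnegative, so every expectation can be taken in
  \<open>[0, \<infinity>]\<close>.

  \<^bold>\<open>Verification.\<close> An admissible decision at the \<open>k\<close>-th observation is a function of the waiting times up
  to \<open>k\<close> and the delays before \<open>k\<close>, hence independent of the \<open>k\<close>-th delay, and the state after
  the \<open>k\<close>-th execution time is independent of the next waiting time
  (\<open>measurable_process\<close>, \<open>nn_integral_fresh_clock\<close>). So one cycle cannot decrease the expectation of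
  the cost so far plus the discounted candidate, and it preserves it under the threshold control
  (\<open>expected_candidate_le\<close>, \<open>expected_candidate_eq\<close>). The discount factor at the \<open>k\<close>-th execution
  time has expectation at most \<open>(\<lambda> / (\<delta> + \<lambda>))\<^sup>k\<close>; the discounted candidate therefore disappears in the
  limit, and almost surely the execution times exhaust the time axis, so that the cost of a path is
  the sum of the costs of its cycles (\<open>path_cost_eq_sum_stage_cost\<close>).
\<close>

section \<open>Cost of idling while an exponential clock runs\<close>

text \<open>
  The integral of \<open>e\<^bsup>-\<delta>s\<^esup>\<close> over those \<open>s \<le> t\<close> at which a state that starts from \<open>y\<close> has been
  depleted, i.e. over \<open>[min t (y / S), t]\<close>.
\<close>

definition idle_cost :: "real \<Rightarrow> real \<Rightarrow> real \<Rightarrow> real \<Rightarrow> real" where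
  "idle_cost S \<delta> y t = (exp (- \<delta> * min t (y / S)) - exp (- \<delta> * t)) / \<delta>"

lemma measurable_idle_cost [measurable]:
  "(\<lambda>(y, t). idle_cost S \<delta> y t) \<in> borel_measurable (borel \<Otimes>\<^sub>M borel)"
  unfolding idle_cost_def by measurable

lemma measurable_deplete [measurable]:
  "(\<lambda>(y, t). deplete S y t) \<in> borel_measurable (borel \<Otimes>\<^sub>M borel)"
  unfolding deplete_def by measurable

lemma idle_cost_nonneg: "\<delta> > 0 \<Longrightarrow> idle_cost S \<delta> y t \<ge> 0"
  unfolding idle_cost_def by (intro divide_nonneg_nonneg) auto

lemma deplete_bounds: "S \<ge> 0 \<Longrightarrow> 0 \<le> y \<Longrightarrow> 0 \<le> t \<Longrightarrow> 0 \<le> deplete S y t \<and> deplete S y t \<le> y"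
  by (auto simp: deplete_def)

lemma deplete_add: "S \<ge> 0 \<Longrightarrow> 0 \<le> t \<Longrightarrow> deplete S y (s + t) = deplete S (deplete S y s) t"
  by (auto simp: deplete_def max_def algebra_simps) (use mult_nonneg_nonneg in force)+

lemma idle_cost_add:
  assumes "S > 0" "0 \<le> y" "0 \<le> s" "0 \<le> t"
  shows "idle_cost S \<delta> y (s + t) = idle_cost S \<delta> y s + exp (- \<delta> * s) * idle_cost S \<delta> (deplete S y s) t"
proof (cases "s \<le> y / S")
  case True
  then have "deplete S y s = y - S * s" using assms by (simp add: deplete_def field_simps)
  moreover have "(y - S * s) / S = y / S - s" using assms by (simp add: diff_divide_distrib)
  moreover have "min (s + t) (y / S) = s + min t (y / S - s)" by (simp add: min_def)
  ultimately show ?thesis using True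
    by (simp add: idle_cost_def diff_divide_distrib right_diff_distrib exp_add[symmetric] distrib_left)
next
  case False
  then have "deplete S y s = 0" using assms by (simp add: deplete_def field_simps)
  then show ?thesis using False assms
    by (simp add: idle_cost_def diff_divide_distrib right_diff_distrib exp_add[symmetric])
      (simp add: algebra_simps)
qed

lemma exp_decay_at_top:
  fixes a :: real
  assumes "a > 0"
  shows "((\<lambda>t. exp (- a * t)) \<longlongrightarrow> 0) at_top"
  using assms
  by (intro filterlim_compose[OF exp_at_bot] filterlim_tendsto_neg_mult_at_bot[of _ "- a"])
    (auto intro: filterlim_ident)

text \<open>
  Expected discounted cost of waiting an exponential time of rate \<open>p\<close> from the state \<open>y\<close> and paying
  \<open>m\<close> of the state reached: by the differential equation for \<open>v\<close>,
  \<open>t \<mapsto> - e\<^bsup>-(\<delta>+p)t\<^esup> v (y - S t)\<close> is an antiderivative of the integrand until the depletion time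
  \<open>y / S\<close>. From then on the state is \<open>0\<close>, idling is charged as well, and the boundary condition at
  \<open>0\<close> makes \<open>- e\<^bsup>-pt\<^esup> (idle cost + e\<^bsup>-\<delta>t\<^esup> v 0)\<close> an antiderivative.
\<close>

lemma nn_integral_exponential_wait:
  assumes pos: "S > 0" "\<delta> > 0" "p > 0" "y \<ge> 0"
    and v: "\<And>x. (v has_real_derivative v' x) (at x)"
    and ode: "\<And>x. S * v' x + (\<delta> + p) * v x = p * m x"
    and v0: "(\<delta> + p) * v 0 = 1 + p * m 0"
    and m [measurable]: "m \<in> borel_measurable borel"
    and m0: "\<And>x. 0 \<le> x \<Longrightarrow> x \<le> y \<Longrightarrow> m x \<ge> 0"
  shows "(\<integral>\<^sup>+ t. ennreal (exponential_density p t)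
      * ennreal (idle_cost S \<delta> y t + exp (- \<delta> * t) * m (deplete S y t)) \<partial>lborel) = ennreal (v y)"
proof -
  define T where "T = y / S"
  have T: "T \<ge> 0" using pos by (simp add: T_def)
  define f1 where "f1 t = p * exp (- (\<delta> + p) * t) * m (y - S * t)" for t
  define F1 where "F1 t = - exp (- (\<delta> + p) * t) * v (y - S * t)" for t
  define f2 where "f2 t = p * exp (- p * t) * ((exp (- \<delta> * T) - exp (- \<delta> * t)) / \<delta> + exp (- \<delta> * t) * m 0)" for t
  define F2 where "F2 t = - exp (- p * t) * ((exp (- \<delta> * T) - exp (- \<delta> * t)) / \<delta> + exp (- \<delta> * t) * v 0)" for t
  have m00: "m 0 \<ge> 0" using m0[of 0] pos by simp
  then have "1 + p * m 0 > 0" using pos by (simp add: add_pos_nonneg)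
  then have v00: "v 0 > 0" using v0 pos by (metis add_pos_pos zero_less_mult_pos)
  have F1': "(F1 has_real_derivative f1 t) (at t)" for t
  proof -
    have "(F1 has_real_derivative exp (- (\<delta> + p) * t) * ((\<delta> + p) * v (y - S * t) + S * v' (y - S * t))) (at t)"
      unfolding F1_def[abs_def]
      by (auto intro!: derivative_eq_intros DERIV_chain2[OF v] simp: algebra_simps)
    moreover have "(\<delta> + p) * v (y - S * t) + S * v' (y - S * t) = p * m (y - S * t)"
      using ode[of "y - S * t"] by simp
    ultimately show ?thesis by (simp add: f1_def mult_ac)
  qed
  have f1_nonneg: "0 \<le> f1 t" if "0 \<le> t" "t \<le> T" for t
  proof -
    have "0 \<le> y - S * t" "y - S * t \<le> y" using that pos by (auto simp: T_def field_simps)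
    then show ?thesis using m0 pos by (simp add: f1_def)
  qed
  have I1: "(\<integral>\<^sup>+ t. ennreal (f1 t) * indicator {0..T} t \<partial>lborel) = ennreal (F1 T - F1 0)"
    by (rule nn_integral_FTC_Icc) (use F1' f1_nonneg T in \<open>auto simp: f1_def\<close>)
  have I2: "(\<integral>\<^sup>+ t. ennreal (f2 t) * indicator {T..} t \<partial>lborel) = ennreal (0 - F2 T)"
  proof (rule nn_integral_FTC_atLeast)
    show "f2 \<in> borel_measurable borel" unfolding f2_def by measurable
    fix t assume t: "T \<le> t"
    have "(F2 has_real_derivative p * exp (- p * t) * ((exp (- \<delta> * T) - exp (- \<delta> * t)) / \<delta>)
        + exp (- p * t) * exp (- \<delta> * t) * ((\<delta> + p) * v 0 - 1)) (at t)"
      unfolding F2_def[abs_def] using pos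
      by (auto intro!: derivative_eq_intros simp: field_simps)
    then show "(F2 has_real_derivative f2 t) (at t)"
      unfolding v0 by (simp add: f2_def algebra_simps)
    show "0 \<le> f2 t" using t pos m00 by (simp add: f2_def)
  next
    have "((\<lambda>t. - (exp (- p * t) * (exp (- \<delta> * T) / \<delta>)) + exp (- (\<delta> + p) * t) * (1 / \<delta> - v 0)) \<longlongrightarrow>
        - (0 * (exp (- \<delta> * T) / \<delta>)) + 0 * (1 / \<delta> - v 0)) at_top"
      using pos by (intro tendsto_intros exp_decay_at_top) auto
    moreover have "- (exp (- p * t) * (exp (- \<delta> * T) / \<delta>)) + exp (- (\<delta> + p) * t) * (1 / \<delta> - v 0) = F2 t" for t
    proof -
      have "exp (- (\<delta> + p) * t) = exp (- p * t) * exp (- \<delta> * t)"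
        by (simp add: exp_add[symmetric] algebra_simps)
      then show ?thesis by (simp add: F2_def diff_divide_distrib algebra_simps)
    qed
    ultimately show "(F2 \<longlongrightarrow> 0) at_top" by (simp add: tendsto_cong)
  qed
  have "(\<integral>\<^sup>+ t. ennreal (exponential_density p t)
      * ennreal (idle_cost S \<delta> y t + exp (- \<delta> * t) * m (deplete S y t)) \<partial>lborel)
    = (\<integral>\<^sup>+ t. ennreal (f1 t) * indicator {0..T} t + ennreal (f2 t) * indicator {T..} t \<partial>lborel)"
  proof (rule nn_integral_cong_AE)
    have "AE t in lborel. t \<noteq> T" by (rule AE_lborel_singleton)
    then show "AE t in lborel. ennreal (exponential_density p t)
      * ennreal (idle_cost S \<delta> y t + exp (- \<delta> * t) * m (deplete S y t))
      = ennreal (f1 t) * indicator {0..T} t + ennreal (f2 t) * indicator {T..} t"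
    proof eventually_elim
      fix t assume "t \<noteq> T"
      then consider "t < 0" | "0 \<le> t" "t < T" | "T < t" by linarith
      then show "ennreal (exponential_density p t)
        * ennreal (idle_cost S \<delta> y t + exp (- \<delta> * t) * m (deplete S y t))
        = ennreal (f1 t) * indicator {0..T} t + ennreal (f2 t) * indicator {T..} t"
      proof cases
        case 1
        then show ?thesis using T by (simp add: exponential_density_def)
      next
        case 2
        then have "deplete S y t = y - S * t" "idle_cost S \<delta> y t = 0"
          using pos by (auto simp: deplete_def idle_cost_def T_def field_simps)
        moreover have "exp (- (\<delta> + p) * t) = exp (- p * t) * exp (- \<delta> * t)"
          by (simp add: exp_add[symmetric] algebra_simps)
        ultimately show ?thesis
          using 2 pos by (simp add: exponential_density_def f1_def ennreal_mult'[symmetric] mult_ac)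
      next
        case 3
        then have "deplete S y t = 0" "min t (y / S) = T"
          using pos by (auto simp: deplete_def T_def field_simps)
        then show ?thesis
          using 3 pos T by (simp add: exponential_density_def idle_cost_def f2_def ennreal_mult'[symmetric] mult_ac)
      qed
    qed
  qed
  also have "\<dots> = ennreal (F1 T - F1 0) + ennreal (0 - F2 T)"
  proof (subst nn_integral_add)
    show "(\<lambda>t. ennreal (f1 t) * indicator {0..T} t) \<in> borel_measurable lborel"
      "(\<lambda>t. ennreal (f2 t) * indicator {T..} t) \<in> borel_measurable lborel"
      unfolding f1_def f2_def by measurable
  qed (simp only: I1 I2)
  also have "0 - F2 T = - F1 T"
  proof -
    have "exp (- (\<delta> + p) * T) = exp (- p * T) * exp (- \<delta> * T)"
      by (simp add: exp_add[symmetric] algebra_simps)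
    moreover have "y - S * T = 0" using pos by (simp add: T_def)
    ultimately show ?thesis by (simp add: F1_def F2_def)
  qed
  also have "ennreal (F1 T - F1 0) + ennreal (- F1 T) = ennreal (- F1 0)"
  proof -
    have "F1 0 \<le> F1 T"
      using F1' f1_nonneg by (intro DERIV_nonneg_imp_nondecreasing[OF T]) blast
    moreover have "- F1 T \<ge> 0" using pos v00 by (simp add: F1_def T_def)
    ultimately show ?thesis by (simp add: ennreal_plus[symmetric])
  qed
  finally show ?thesis by (simp add: F1_def)
qed

lemma nn_integral_exponential_discount:
  assumes "\<delta> > 0" "p > 0"
  shows "(\<integral>\<^sup>+ t. ennreal (exponential_density p t) * ennreal (exp (- \<delta> * t)) \<partial>lborel) = ennreal (p / (\<delta> + p))"
proof -
  define F where "F t = - (p / (\<delta> + p)) * exp (- (\<delta> + p) * t)" for t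
  have "(\<integral>\<^sup>+ t. ennreal (exponential_density p t) * ennreal (exp (- \<delta> * t)) \<partial>lborel)
    = (\<integral>\<^sup>+ t. ennreal (p * exp (- (\<delta> + p) * t)) * indicator {0..} t \<partial>lborel)"
    using assms by (intro nn_integral_cong)
      (auto simp: exponential_density_def ennreal_mult'[symmetric] exp_add[symmetric] algebra_simps split: split_indicator)
  also have "\<dots> = ennreal (0 - F 0)"
  proof (rule nn_integral_FTC_atLeast)
    show "(F has_real_derivative p * exp (- (\<delta> + p) * t)) (at t)" for t
      unfolding F_def[abs_def] using assms
      by (auto intro!: derivative_eq_intros simp: minus_add_distrib[symmetric] simp del: minus_add_distrib)
    have "((\<lambda>t. exp (- (\<delta> + p) * t)) \<longlongrightarrow> 0) at_top"
      using assms by (intro exp_decay_at_top) simp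
    then show "(F \<longlongrightarrow> 0) at_top" unfolding F_def[abs_def] by (rule tendsto_mult_right_zero)
  qed (use assms in auto)
  finally show ?thesis by (simp add: F_def)
qed

section \<open>The cost of a path as a sum over observation cycles\<close>

lemma post_state_bounds:
  assumes "S > 0" "x \<in> {0..1}" and "\<And>k. k \<ge> 1 \<Longrightarrow> W k > 0" "\<And>k. k \<ge> 1 \<Longrightarrow> om k > 0"
  shows "post_state S x W om \<theta> k \<in> {0..1}"
proof (induction k)
  case (Suc k)
  have "0 \<le> W (Suc k) + exec_delay om \<theta> (Suc k)"
    using assms(3,4)[of "Suc k"] by (simp add: exec_delay_def)
  then show ?case using Suc assms(1) deplete_bounds[of S "post_state S x W om \<theta> k" "W (Suc k) + exec_delay om \<theta> (Suc k)"] by simp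
qed (use assms in simp)

text \<open>
  Discounted cost incurred between the execution times \<open>k\<close> and \<open>k + 1\<close>, with the waiting time and the
  delay separated because the decision is taken between them. A replenishment is always charged the
  fixed cost \<open>d\<close>: on paths with positive waiting times and delays its amount is positive.
\<close>

definition stage_cost ::
    "real \<Rightarrow> real \<Rightarrow> real \<Rightarrow> real \<Rightarrow> real \<Rightarrow> (nat \<Rightarrow> real) \<Rightarrow> (nat \<Rightarrow> real) \<Rightarrow> (nat \<Rightarrow> bool) \<Rightarrow> nat \<Rightarrow> real" where
  "stage_cost S \<delta> c d x W om \<theta> k =
     exp (- \<delta> * exec_time W om \<theta> k) *
       (idle_cost S \<delta> (post_state S x W om \<theta> k) (W (Suc k))
        + exp (- \<delta> * W (Suc k)) *
           (if \<theta> (Suc k)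
            then idle_cost S \<delta> (obs_state S x W om \<theta> (Suc k)) (om (Suc k))
                 + exp (- \<delta> * om (Suc k)) * (c * (1 - deplete S (obs_state S x W om \<theta> (Suc k)) (om (Suc k))) + d)
            else 0))"

text \<open>
  The intervals between consecutive execution times partition the positive half-line, and inside each
  of them the state vanishes exactly from its depletion time on. The time \<open>0\<close> is a null set.
\<close>

lemma path_cost_eq_sum_stage_cost:
  assumes S: "S > 0" and pos: "\<delta> > 0" "c > 0" "d > 0" and x: "x \<in> {0..1}"
    and W: "\<And>k. k \<ge> 1 \<Longrightarrow> W k > 0" and om: "\<And>k. k \<ge> 1 \<Longrightarrow> om k > 0" and \<theta>0: "\<not> \<theta> 0"
    and unbounded: "\<And>t. \<exists>k. t \<le> exec_time W om \<theta> k"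
  shows "path_cost S \<delta> c d x W om \<theta> = (\<Sum>k. ennreal (stage_cost S \<delta> c d x W om \<theta> k))"
proof -
  let ?T = "exec_time W om \<theta>" and ?Y = "post_state S x W om \<theta>"
  \<comment> \<open>The times in cycle \<open>k\<close> at which the state is depleted.\<close>
  define A where "A k = {s. ?T k < s \<and> s \<le> ?T (Suc k) \<and> ?T k + ?Y k / S \<le> s}" for k
  have Y: "?Y k \<in> {0..1}" for k by (rule post_state_bounds[where W = W and om = om, OF S x W om])
  have mono: "strict_mono ?T" by (rule strict_mono_exec_time[of W om \<theta>, OF W om \<theta>0])
  have T0: "?T 0 = 0" by (rule exec_time_0[of W om \<theta>, OF W om \<theta>0])
  have A_measurable [measurable]: "A k \<in> sets borel" for k
    unfolding A_def by measurable
  have disj: "disjoint_family A"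
    unfolding disjoint_family_on_def
  proof (intro ballI impI)
    fix i j :: nat assume "i \<noteq> j"
    have "A i \<inter> A j = {}" if "i < j" for i j
      using strict_mono_less_eq[OF mono, of "Suc i" j] that by (auto simp: A_def)
    then show "A i \<inter> A j = {}" using \<open>i \<noteq> j\<close> by (metis Int_commute linorder_neqE_nat)
  qed
  have zero: "indicator {s. 0 \<le> s \<and> state S x W om \<theta> s = 0} s = (indicator (\<Union>k. A k) s :: ennreal)"
    if "s \<noteq> 0" for s
  proof (cases "s > 0")
    case True
    define k where "k = (LEAST k. s \<le> ?T k)"
    have "s \<le> ?T k" unfolding k_def using unbounded[of s] by (rule LeastI_ex)
    then have "k \<noteq> 0" using True T0 by (metis not_le)
    then obtain j where j: "k = Suc j" by (cases k) auto
    then have "?T j < s" using not_less_Least[of j "\<lambda>k. s \<le> ?T k"] by (simp add: k_def not_le)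
    moreover have "s \<le> ?T (Suc j)" using \<open>s \<le> ?T k\<close> j by simp
    ultimately have *: "state S x W om \<theta> s = deplete S (?Y j) (s - ?T j)"
      using state_between[of W om \<theta> j s S x] W om \<theta>0 by blast
    have "s \<in> A j \<longleftrightarrow> state S x W om \<theta> s = 0"
      using \<open>?T j < s\<close> \<open>s \<le> ?T (Suc j)\<close> S unfolding * by (auto simp: A_def deplete_def field_simps max_def)
    moreover have "s \<in> A i \<Longrightarrow> i = j" for i
      using \<open>?T j < s\<close> \<open>s \<le> ?T (Suc j)\<close> strict_mono_less_eq[OF mono, of "Suc i" j]
        strict_mono_less_eq[OF mono, of "Suc j" i] unfolding A_def
      by (smt (verit) less_eq_Suc_le linorder_neqE_nat mem_Collect_eq)
    ultimately show ?thesis using True by (auto simp: indicator_def)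
  next
    case False
    have "0 \<le> ?T k" for k using strict_mono_less_eq[OF mono, of 0 k] T0 by simp
    then have "s \<notin> A k" for k using False by (smt (verit) A_def mem_Collect_eq)
    then show ?thesis using False that by (simp add: indicator_def)
  qed
  have A_int: "(\<integral>\<^sup>+ s. ennreal (exp (- \<delta> * s)) * indicator (A k) s \<partial>lborel)
      = ennreal (exp (- \<delta> * ?T k) * idle_cost S \<delta> (?Y k) (W (Suc k) + exec_delay om \<theta> (Suc k)))" for k
  proof -
    define a where "a = min (?T (Suc k)) (?T k + ?Y k / S)"
    have "?T k < ?T (Suc k)" using mono by (simp add: strict_mono_Suc_iff)
    moreover have "?Y k / S \<ge> 0" using Y[of k] S by simp
    ultimately have a: "?T k \<le> a" "a \<le> ?T (Suc k)" by (auto simp: a_def)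
    have "(\<integral>\<^sup>+ s. ennreal (exp (- \<delta> * s)) * indicator (A k) s \<partial>lborel)
        = (\<integral>\<^sup>+ s. ennreal (exp (- \<delta> * s)) * indicator {a..?T (Suc k)} s \<partial>lborel)"
    proof (rule nn_integral_cong_AE)
      have "AE s in lborel. s \<noteq> ?T k" "AE s in lborel. s \<noteq> ?T (Suc k)" by (rule AE_lborel_singleton)+
      then show "AE s in lborel. ennreal (exp (- \<delta> * s)) * indicator (A k) s
          = ennreal (exp (- \<delta> * s)) * indicator {a..?T (Suc k)} s"
        by eventually_elim (use a in \<open>auto simp: A_def a_def indicator_def\<close>)
    qed
    also have "\<dots> = ennreal (- exp (- \<delta> * ?T (Suc k)) / \<delta> - - exp (- \<delta> * a) / \<delta>)"
      using pos a by (intro nn_integral_FTC_Icc) (auto intro!: derivative_eq_intros)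
    also have "- exp (- \<delta> * ?T (Suc k)) / \<delta> - - exp (- \<delta> * a) / \<delta>
        = exp (- \<delta> * ?T k) * idle_cost S \<delta> (?Y k) (W (Suc k) + exec_delay om \<theta> (Suc k))"
    proof -
      have "a = ?T k + min (W (Suc k) + exec_delay om \<theta> (Suc k)) (?Y k / S)"
        by (simp add: a_def exec_time_def min_def)
      moreover have "?T (Suc k) = ?T k + (W (Suc k) + exec_delay om \<theta> (Suc k))"
        by (simp add: exec_time_def)
      ultimately show ?thesis
        by (simp only: idle_cost_def) (simp add: right_diff_distrib diff_divide_distrib mult_exp_exp distrib_left add_ac)
    qed
    finally show ?thesis .
  qed
  have "(\<integral>\<^sup>+ s. ennreal (exp (- \<delta> * s)) * indicator {s. 0 \<le> s \<and> state S x W om \<theta> s = 0} s \<partial>lborel)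
      = (\<integral>\<^sup>+ s. (\<Sum>k. ennreal (exp (- \<delta> * s)) * indicator (A k) s) \<partial>lborel)"
  proof (rule nn_integral_cong_AE)
    have "AE s in lborel. s \<noteq> (0::real)" by (rule AE_lborel_singleton)
    then show "AE s in lborel. ennreal (exp (- \<delta> * s)) * indicator {s. 0 \<le> s \<and> state S x W om \<theta> s = 0} s
        = (\<Sum>k. ennreal (exp (- \<delta> * s)) * indicator (A k) s)"
      by eventually_elim (simp add: zero suminf_indicator[OF disj])
  qed
  also have "\<dots> = (\<Sum>k. ennreal (exp (- \<delta> * ?T k) * idle_cost S \<delta> (?Y k) (W (Suc k) + exec_delay om \<theta> (Suc k))))"
    by (subst nn_integral_suminf) (simp, simp only: A_int)
  finally have "path_cost S \<delta> c d x W om \<theta>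
      = (\<Sum>k. ennreal (exp (- \<delta> * ?T k) * idle_cost S \<delta> (?Y k) (W (Suc k) + exec_delay om \<theta> (Suc k)))
           + ennreal (exp (- \<delta> * ?T (Suc k))
              * (c * replenishment S x W om \<theta> (Suc k)
                 + d * (if replenishment S x W om \<theta> (Suc k) > 0 then 1 else 0))))"
    unfolding path_cost_def by (simp only: suminf_add[OF summableI summableI])
  also have "\<dots> = (\<Sum>k. ennreal (stage_cost S \<delta> c d x W om \<theta> k))"
  proof (intro suminf_cong)
    fix k
    have Wk: "W (Suc k) > 0" "om (Suc k) > 0" using W om by auto
    let ?z = "obs_state S x W om \<theta> (Suc k)"
    have z: "?z = deplete S (?Y k) (W (Suc k))" by (simp add: obs_state_def)
    have z01: "0 \<le> ?z" "?z \<le> 1"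
      using deplete_bounds[of S "?Y k" "W (Suc k)"] Y[of k] S Wk unfolding z by auto
    have "exp (- \<delta> * ?T k) * idle_cost S \<delta> (?Y k) (W (Suc k) + exec_delay om \<theta> (Suc k)) \<ge> 0"
      using pos by (simp add: idle_cost_nonneg)
    moreover have "exp (- \<delta> * ?T k) * idle_cost S \<delta> (?Y k) (W (Suc k) + exec_delay om \<theta> (Suc k))
        + exp (- \<delta> * ?T (Suc k)) * (c * replenishment S x W om \<theta> (Suc k)
                 + d * (if replenishment S x W om \<theta> (Suc k) > 0 then 1 else 0))
        = stage_cost S \<delta> c d x W om \<theta> k
      \<and> c * replenishment S x W om \<theta> (Suc k) + d * (if replenishment S x W om \<theta> (Suc k) > 0 then 1 else 0) \<ge> 0"
    proof (cases "\<theta> (Suc k)")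
      case True
      have pre: "pre_state S x W om \<theta> (Suc k) = deplete S ?z (om (Suc k))"
        unfolding z using True S Wk by (simp add: pre_state_def exec_delay_def deplete_add)
      have "deplete S ?z (om (Suc k)) < 1" using z01 S Wk by (simp add: deplete_def less_le_trans)
          (smt (verit) mult_pos_pos)
      then have amount: "replenishment S x W om \<theta> (Suc k) = 1 - deplete S ?z (om (Suc k))"
        "replenishment S x W om \<theta> (Suc k) > 0"
        using True by (auto simp: replenishment_def pre)
      have discount: "exp (- \<delta> * ?T (Suc k)) = exp (- \<delta> * ?T k) * exp (- \<delta> * W (Suc k)) * exp (- \<delta> * om (Suc k))"
        using True by (simp add: exec_time_def exec_delay_def mult_exp_exp algebra_simps)
      have idle: "idle_cost S \<delta> (?Y k) (W (Suc k) + exec_delay om \<theta> (Suc k))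
          = idle_cost S \<delta> (?Y k) (W (Suc k)) + exp (- \<delta> * W (Suc k)) * idle_cost S \<delta> ?z (om (Suc k))"
        unfolding z using True S Wk Y[of k] by (subst idle_cost_add[symmetric]) (auto simp: exec_delay_def)
      have price: "c * replenishment S x W om \<theta> (Suc k) + d * (if replenishment S x W om \<theta> (Suc k) > 0 then 1 else 0)
          = c * (1 - deplete S ?z (om (Suc k))) + d"
        using amount by simp
      have "c * (1 - deplete S ?z (om (Suc k))) + d \<ge> 0"
        using amount pos by simp
      then show ?thesis
        unfolding price discount idle stage_cost_def using True by (simp add: algebra_simps)
    next
      case False
      then show ?thesis by (simp add: stage_cost_def exec_delay_def replenishment_def)
    qed
    ultimately show "ennreal (exp (- \<delta> * ?T k) * idle_cost S \<delta> (?Y k) (W (Suc k) + exec_delay om \<theta> (Suc k)))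
           + ennreal (exp (- \<delta> * ?T (Suc k))
              * (c * replenishment S x W om \<theta> (Suc k)
                 + d * (if replenishment S x W om \<theta> (Suc k) > 0 then 1 else 0)))
        = ennreal (stage_cost S \<delta> c d x W om \<theta> k)"
      by (metis (no_types, lifting) ennreal_plus exp_ge_zero mult_nonneg_nonneg)
  qed
  finally show ?thesis .
qed

section \<open>The free boundary problem\<close>

text \<open>
  The sign of \<open>h\<close> decides whether \<open>U\<close> and \<open>V\<close> increase, and by quasiconcavity \<open>h\<close> is nonnegative on an
  interval. If \<open>h b < 0\<close>, then \<open>h\<close> is negative on one whole side of \<open>b\<close>: on the left, this
  would make \<open>U\<close> start negative and decrease, so that it could not vanish at \<open>b\<close>; on the
  right, it would make \<open>V\<close> decrease from \<open>0\<close> while \<open>V 1 > 0\<close>. Hence \<open>h b \<ge> 0\<close>, and a wrong sign of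
  \<open>U\<close> or \<open>V\<close> somewhere produces a point with \<open>h < 0\<close> on the same side of \<open>b\<close>. From there \<open>h\<close> stays
  negative up to \<open>0\<close> or \<open>1\<close> respectively, which contradicts the condition at that end.
\<close>

lemma single_crossing:
  fixes h U V p q :: "real \<Rightarrow> real"
  assumes quasiconcave: "\<And>x y z. 0 \<le> x \<Longrightarrow> x \<le> y \<Longrightarrow> y \<le> z \<Longrightarrow> z \<le> 1 \<Longrightarrow> min (h x) (h z) \<le> h y"
    and U: "\<And>x. (U has_real_derivative p x * h x) (at x)" and p: "\<And>x. p x > 0"
    and V: "\<And>x. (V has_real_derivative q x * h x) (at x)" and q: "\<And>x. q x > 0"
    and b: "0 < b" "b < 1" and U0: "U 0 = \<kappa> * h 0" "\<kappa> > 0"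
    and Ub: "U b = 0" and Vb: "V b = 0" and V1: "h 1 \<le> 0 \<Longrightarrow> V 1 > 0"
  shows "h b \<ge> 0"
    and "0 \<le> x \<Longrightarrow> x \<le> b \<Longrightarrow> U x \<le> 0"
    and "b \<le> x \<Longrightarrow> x \<le> 1 \<Longrightarrow> V x \<ge> 0"
proof -
  have up: "f r \<le> f s"
    if "\<And>x. (f has_real_derivative w x * h x) (at x)" "\<And>x. w x > 0" "r \<le> s"
      "\<And>y. r \<le> y \<Longrightarrow> y \<le> s \<Longrightarrow> h y \<ge> 0" for f w r s
    using that by (intro DERIV_nonneg_imp_nondecreasing[of r s f]) (auto intro!: exI mult_nonneg_nonneg simp: less_imp_le)
  have down: "f s \<le> f r"
    if "\<And>x. (f has_real_derivative w x * h x) (at x)" "\<And>x. w x > 0" "r \<le> s"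
      "\<And>y. r \<le> y \<Longrightarrow> y \<le> s \<Longrightarrow> h y \<le> 0" for f w r s
    using that by (intro DERIV_nonpos_imp_nonincreasing[of r s f])
      (auto intro!: exI mult_nonneg_nonpos simp: less_imp_le)
  show hb: "h b \<ge> 0"
  proof (rule ccontr)
    assume neg: "\<not> h b \<ge> 0"
    have "\<exists>y. 0 \<le> y \<and> y \<le> b \<and> h y \<ge> 0"
    proof (rule ccontr)
      assume "\<not> ?thesis"
      then have "h y < 0" if "0 \<le> y" "y \<le> b" for y using that by force
      then have "U b \<le> U 0" "h 0 < 0" using down[OF U p, of 0 b] b by (auto simp: less_imp_le)
      then show False using Ub U0 by (simp add: mult_pos_neg less_le_not_le zero_le_mult_iff)
    qed
    then obtain y where y: "0 \<le> y" "y \<le> b" "h y \<ge> 0" by blast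
    have "h z < 0" if "b \<le> z" "z \<le> 1" for z using quasiconcave[of y b z] y neg that by linarith
    then have "V 1 \<le> V b" "h 1 \<le> 0" using down[OF V q, of b 1] b by (auto simp: less_imp_le)
    then show False using V1 Vb by simp
  qed
  show "U x \<le> 0" if x: "0 \<le> x" "x \<le> b"
  proof (rule ccontr)
    assume pos: "\<not> U x \<le> 0"
    have "\<exists>y. x \<le> y \<and> y \<le> b \<and> h y < 0"
      using up[OF U p, of x b] x Ub pos by force
    then obtain y where y: "x \<le> y" "y \<le> b" "h y < 0" by blast
    have "h z < 0" if "0 \<le> z" "z \<le> y" for z
      using quasiconcave[of z y b] y hb b that by linarith
    then have "U x \<le> U 0" "h 0 < 0" using down[OF U p, of 0 x] x y by (auto simp: less_imp_le)
    then show False using pos U0 by (simp add: mult_less_0_iff zero_less_mult_iff not_le)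
      (smt (verit) mult_pos_neg)
  qed
  show "V x \<ge> 0" if x: "b \<le> x" "x \<le> 1"
  proof (rule ccontr)
    assume neg: "\<not> V x \<ge> 0"
    have "\<exists>y. b \<le> y \<and> y \<le> x \<and> h y < 0"
      using up[OF V q, of b x] x Vb neg by force
    then obtain y where y: "b \<le> y" "y \<le> x" "h y < 0" by blast
    have "h z < 0" if "y \<le> z" "z \<le> 1" for z
      using quasiconcave[of b y z] y hb b that by linarith
    then have "V 1 \<le> V x" "h 1 \<le> 0" using down[OF V q, of x 1] x y by (auto simp: less_imp_le)
    then show False using neg V1 by simp
  qed
qed

lemma exp_mult_deriv:
  fixes f :: "real \<Rightarrow> real"
  assumes "(f has_real_derivative D) (at x)"
  shows "((\<lambda>x. exp (r * x) * f x) has_real_derivative exp (r * x) * (r * f x + D)) (at x)"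
  using assms by (auto intro!: derivative_eq_intros simp: algebra_simps)

text \<open>
  \<open>AK\<close> stands for the constant \<open>A(K)\<close>, as only this value of the affine function \<open>A\<close> matters once
  \<open>K\<close> is fixed.
\<close>

locale free_boundary =
  fixes S \<delta> c d lam mu \<alpha> \<beta> \<gamma> B C G K xbar AK :: real
  assumes S: "S > 0" and \<delta>: "\<delta> > 0" and c: "c > 0" and d: "d > 0" and lam: "lam > 0" and mu: "mu > lam"
    and \<alpha>: "\<alpha> = mu / (\<delta> + mu) * (c + d + c * S / (\<delta> + mu))"
    and \<beta>: "\<beta> = mu / (\<delta> + mu)"
    and \<gamma>: "\<gamma> = 1 / (\<delta> + mu) - mu * c * S / (\<delta> + mu)\<^sup>2"
    and AK: "AK = lam * \<alpha> / (\<delta> + lam) + lam * c * S * \<beta> / (\<delta> + lam)\<^sup>2 + lam * \<beta> * K / (\<delta> + lam)"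
    and B: "B = - (lam * c * \<beta> / (\<delta> + lam))"
    and C: "C = - (lam / (mu - lam) * \<gamma>)"
    and G: "G = 1 / (\<delta> + lam) * (1 - lam * c * S * \<beta> / (\<delta> + lam)
                + lam * (\<delta> + mu) * \<gamma> / (mu - lam))"
    and xbar: "0 < xbar" "xbar < 1"
    and value_matching:
      "G * exp (- (\<delta> + lam) / S * xbar) + AK + B * xbar + C * exp (- (\<delta> + mu) / S * xbar)
         = K * exp (\<delta> / S * (1 - xbar))"
    and smooth_fit:
      "- (\<delta> + lam) / S * G * exp (- (\<delta> + lam) / S * xbar) + B
         - (\<delta> + mu) / S * C * exp (- (\<delta> + mu) / S * xbar)
         = - \<delta> / S * K * exp (\<delta> / S * (1 - xbar))"
begin

text \<open>
  Expected cost of replenishing from the observed state \<open>z\<close> when the cost after execution is \<open>K\<close>; that it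
  is this expectation is \<open>wait_replenish_value\<close> below.
\<close>

definition replenish_value :: "real \<Rightarrow> real" where
  "replenish_value z = \<alpha> + \<beta> * K - c * \<beta> * z + \<gamma> * exp (- (\<delta> + mu) / S * z)"

definition replenish_value' :: "real \<Rightarrow> real" where
  "replenish_value' z = - c * \<beta> - (\<delta> + mu) / S * \<gamma> * exp (- (\<delta> + mu) / S * z)"

definition lower :: "real \<Rightarrow> real" where
  "lower x = G * exp (- (\<delta> + lam) / S * x) + AK + B * x + C * exp (- (\<delta> + mu) / S * x)"

definition lower' :: "real \<Rightarrow> real" where
  "lower' x = - (\<delta> + lam) / S * G * exp (- (\<delta> + lam) / S * x) + B
                - (\<delta> + mu) / S * C * exp (- (\<delta> + mu) / S * x)"

definition upper :: "real \<Rightarrow> real" where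
  "upper x = K * exp (\<delta> / S * (1 - x))"

definition candidate :: "real \<Rightarrow> real" where
  "candidate x = (if x \<le> xbar then lower x else upper x)"

definition candidate' :: "real \<Rightarrow> real" where
  "candidate' x = (if x \<le> xbar then lower' x else - \<delta> / S * upper x)"

text \<open>
  Cost at an observation under the threshold rule. By \<open>obs_value_le\<close> it is the minimum of the two
  options.
\<close>

definition obs_value :: "real \<Rightarrow> real" where
  "obs_value x = (if x \<le> xbar then replenish_value x else candidate x)"

text \<open>
  The source term in the linear equations for the gap between replenishing and the candidate on
  either side of the threshold.
\<close>

definition gap_source :: "real \<Rightarrow> real" where
  "gap_source x = S * replenish_value' x + \<delta> * replenish_value x"

lemma mu_pos: "mu > 0" and \<beta>_pos: "\<beta> > 0"
  using lam mu \<delta> by (auto simp: \<beta>)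

lemma replenish_value_deriv: "(replenish_value has_real_derivative replenish_value' x) (at x)"
  unfolding replenish_value_def[abs_def] replenish_value'_def using S
  by (auto intro!: derivative_eq_intros simp: field_simps)

lemma lower_deriv: "(lower has_real_derivative lower' x) (at x)"
  unfolding lower_def[abs_def] lower'_def using S
  by (auto intro!: derivative_eq_intros simp: field_simps)

lemma upper_deriv: "(upper has_real_derivative - \<delta> / S * upper x) (at x)"
  unfolding upper_def[abs_def] using S
  by (auto intro!: derivative_eq_intros simp: field_simps)

lemma lower_upper_xbar: "lower xbar = upper xbar" "lower' xbar = - \<delta> / S * upper xbar"
  using value_matching smooth_fit by (simp_all add: lower_def upper_def lower'_def)

lemma candidate_deriv: "(candidate has_real_derivative candidate' x) (at x)"
proof -
  have "((\<lambda>x. if x \<in> {..xbar} then lower x else upper x) has_vector_derivative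
      (if x \<in> {..xbar} then lower' x else - \<delta> / S * upper x)) (at x within UNIV)"
  proof (rule has_vector_derivative_If_within_closures[where T = "{xbar<..}"])
    fix s
    show "(lower has_vector_derivative lower' x) (at x within s)"
      and "(upper has_vector_derivative - \<delta> / S * upper x) (at x within s)" for s
      using lower_deriv[of x] upper_deriv[of x]
      by (auto intro: has_vector_derivative_at_within simp: has_real_derivative_iff_has_vector_derivative)
    assume "x \<in> closure {..xbar}" "x \<in> closure {xbar<..}"
    then have "x = xbar" by simp
    then show "lower x = upper x" "lower' x = - \<delta> / S * upper x" using lower_upper_xbar by auto
  qed auto
  then show ?thesis
    by (simp add: candidate_def[abs_def] candidate'_def has_real_derivative_iff_has_vector_derivative)
qed

text \<open>
  The constants multiplied by the rates, the form in which they enter the differential equations.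
\<close>

lemma scaled_coefficients:
  "(\<delta> + mu) * \<alpha> = mu * (c + d) + S * c * \<beta>" "(\<delta> + mu) * \<beta> = mu" "(\<delta> + mu) * \<gamma> = 1 - S * c * \<beta>"
  "(\<delta> + lam) * AK = lam * \<alpha> + lam * c * S * \<beta> / (\<delta> + lam) + lam * \<beta> * K"
  "(\<delta> + lam) * B = - lam * c * \<beta>" "(mu - lam) * C = - lam * \<gamma>"
  "(\<delta> + lam) * G = 1 - lam * c * S * \<beta> / (\<delta> + lam) + lam * (\<delta> + mu) * \<gamma> / (mu - lam)"
proof -
  have pos: "\<delta> + mu > 0" "\<delta> + lam > 0" "mu - lam > 0" using \<delta> lam mu by auto
  show "(\<delta> + mu) * \<beta> = mu" "(\<delta> + lam) * B = - lam * c * \<beta>" "(mu - lam) * C = - lam * \<gamma>"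
    "(\<delta> + lam) * G = 1 - lam * c * S * \<beta> / (\<delta> + lam) + lam * (\<delta> + mu) * \<gamma> / (mu - lam)"
    using pos by (simp_all add: \<beta> B C G)
  have "\<alpha> = \<beta> * (c + d + c * S / (\<delta> + mu))" by (simp add: \<alpha> \<beta>)
  then have "(\<delta> + mu) * \<alpha> = mu * (c + d + c * S / (\<delta> + mu))"
    using \<open>(\<delta> + mu) * \<beta> = mu\<close> by (metis mult.assoc)
  also have "\<dots> = mu * (c + d) + S * c * \<beta>" by (simp add: \<beta> algebra_simps)
  finally show "(\<delta> + mu) * \<alpha> = mu * (c + d) + S * c * \<beta>" .
  have "\<gamma> = (1 - S * c * \<beta>) / (\<delta> + mu)"
    by (simp add: \<gamma> \<beta> power2_eq_square diff_divide_distrib mult_ac)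
  then show "(\<delta> + mu) * \<gamma> = 1 - S * c * \<beta>" using pos by simp
  have "AK = (lam * \<alpha> + lam * c * S * \<beta> / (\<delta> + lam) + lam * \<beta> * K) / (\<delta> + lam)"
    by (simp add: AK power2_eq_square add_divide_distrib)
  then show "(\<delta> + lam) * AK = lam * \<alpha> + lam * c * S * \<beta> / (\<delta> + lam) + lam * \<beta> * K"
    using pos by simp
qed

lemma S_replenish_value': "S * replenish_value' z = - S * c * \<beta> - (\<delta> + mu) * \<gamma> * exp (- (\<delta> + mu) / S * z)"
  using S by (simp add: replenish_value'_def right_diff_distrib)

lemma S_lower': "S * lower' x = - (\<delta> + lam) * G * exp (- (\<delta> + lam) / S * x) + S * B
    - (\<delta> + mu) * C * exp (- (\<delta> + mu) / S * x)"
  using S by (simp add: lower'_def right_diff_distrib distrib_left)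

lemma replenish_value_ode: "S * replenish_value' x + (\<delta> + mu) * replenish_value x = mu * (c * (1 - x) + d + K)"
proof -
  have "S * replenish_value' x + (\<delta> + mu) * replenish_value x
      = (\<delta> + mu) * \<alpha> + (\<delta> + mu) * \<beta> * K - c * ((\<delta> + mu) * \<beta>) * x - S * c * \<beta>"
    unfolding S_replenish_value' by (simp add: replenish_value_def algebra_simps)
  also have "\<dots> = mu * (c * (1 - x) + d + K)"
    unfolding scaled_coefficients by (simp add: algebra_simps)
  finally show ?thesis .
qed

lemma replenish_value_0: "(\<delta> + mu) * replenish_value 0 = 1 + mu * (c + d + K)"
proof -
  have "(\<delta> + mu) * replenish_value 0 = (\<delta> + mu) * \<alpha> + (\<delta> + mu) * \<beta> * K + (\<delta> + mu) * \<gamma>"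
    by (simp add: replenish_value_def algebra_simps)
  also have "\<dots> = 1 + mu * (c + d + K)"
    unfolding scaled_coefficients by (simp add: algebra_simps)
  finally show ?thesis .
qed

lemma lower_ode: "S * lower' x + (\<delta> + lam) * lower x = lam * replenish_value x"
proof -
  define E where "E = exp (- (\<delta> + mu) / S * x)"
  have "S * lower' x + (\<delta> + lam) * lower x
      = S * B + (\<delta> + lam) * AK + (\<delta> + lam) * B * x - (mu - lam) * C * E"
    unfolding S_lower' by (simp add: lower_def E_def algebra_simps)
  also have "S * B = - lam * c * S * \<beta> / (\<delta> + lam)" by (simp add: B)
  finally show ?thesis unfolding scaled_coefficients by (simp add: replenish_value_def E_def algebra_simps)
qed

lemma lower_0: "(\<delta> + lam) * lower 0 = 1 + lam * replenish_value 0"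
proof -
  have "(\<delta> + lam) * lower 0 = (\<delta> + lam) * G + (\<delta> + lam) * AK + (\<delta> + lam) * C"
    by (simp add: lower_def algebra_simps)
  also have "(\<delta> + lam) * C = - (lam * (\<delta> + lam) * \<gamma> / (mu - lam))" by (simp add: C)
  finally have "(\<delta> + lam) * lower 0 = 1 + lam * \<alpha> + lam * \<beta> * K
      + (lam * (\<delta> + mu) * \<gamma> / (mu - lam) - lam * (\<delta> + lam) * \<gamma> / (mu - lam))"
    unfolding scaled_coefficients by simp
  also have "lam * (\<delta> + mu) * \<gamma> / (mu - lam) - lam * (\<delta> + lam) * \<gamma> / (mu - lam)
      = (mu - lam) * (lam * \<gamma>) / (mu - lam)"
    unfolding diff_divide_distrib[symmetric] by (simp add: algebra_simps)
  also have "\<dots> = lam * \<gamma>" using mu by simp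
  finally show ?thesis by (simp add: replenish_value_def algebra_simps)
qed

text \<open>
  The expression \<open>S v' + \<delta> v\<close> is \<open>lam\<close> times the gap for \<open>lower\<close> and \<open>0\<close> for \<open>upper\<close>; a continuously
  differentiable fit makes the two agree at \<open>xbar\<close>.
\<close>

lemma replenish_value_xbar: "replenish_value xbar = upper xbar"
  using lower_ode[of xbar] S lam by (simp add: lower_upper_xbar algebra_simps)

lemma gap_source_0: "gap_source 0 = \<delta> * replenish_value 0 - 1"
proof -
  have "S * replenish_value' 0 = - S * c * \<beta> - (\<delta> + mu) * \<gamma>" unfolding S_replenish_value' by simp
  then show ?thesis unfolding scaled_coefficients by (simp add: gap_source_def)
qed

text \<open>
  At the full state the right-hand side of \<open>replenish_value_ode\<close> is \<open>mu (d + K)\<close>, and \<open>K\<close> is also the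
  value of the candidate there. This ties the sign of the source at \<open>1\<close> to the gap at \<open>1\<close>.
\<close>

lemma gap_source_1: "gap_source 1 = mu * (d - (replenish_value 1 - K))"
  using replenish_value_ode[of 1] by (simp add: gap_source_def algebra_simps)

lemma gap_source_eq:
  "gap_source x = \<delta> * (\<alpha> + \<beta> * K) - S * c * \<beta> - \<delta> * c * \<beta> * x - mu * \<gamma> * exp (- (\<delta> + mu) / S * x)"
  unfolding gap_source_def S_replenish_value' by (simp add: replenish_value_def algebra_simps)

lemma gap_source_deriv:
  "(gap_source has_real_derivative mu * (\<delta> + mu) / S * \<gamma> * exp (- (\<delta> + mu) / S * x) - \<delta> * c * \<beta>) (at x)"
  (is "(_ has_real_derivative ?f x) _")
  unfolding gap_source_eq[abs_def] using S
  by (auto intro!: derivative_eq_intros simp: field_simps)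

text \<open>
  For \<open>\<gamma> \<ge> 0\<close> the derivative of the source is decreasing, so its sign changes at most once, from
  positive to negative. For \<open>\<gamma> < 0\<close> the derivative is negative everywhere.
\<close>

lemma gap_source_quasiconcave:
  assumes "x \<le> y" "y \<le> z" shows "min (gap_source x) (gap_source z) \<le> gap_source y"
proof -
  let ?f = "\<lambda>x. mu * (\<delta> + mu) / S * \<gamma> * exp (- (\<delta> + mu) / S * x) - \<delta> * c * \<beta>"
  have pos: "mu * (\<delta> + mu) / S > 0" "\<delta> * c * \<beta> > 0" using S \<delta> c mu_pos \<beta>_pos by auto
  have mono: "?f w \<le> ?f v" if "0 \<le> \<gamma>" "v \<le> w" for v w
  proof -
    have "exp (- (\<delta> + mu) / S * w) \<le> exp (- (\<delta> + mu) / S * v)"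
      using that S \<delta> mu_pos by (simp add: divide_right_mono mult_left_mono)
    then have "mu * (\<delta> + mu) / S * \<gamma> * exp (- (\<delta> + mu) / S * w)
        \<le> mu * (\<delta> + mu) / S * \<gamma> * exp (- (\<delta> + mu) / S * v)"
      using that pos by (intro mult_left_mono mult_nonneg_nonneg) auto
    then show ?thesis by simp
  qed
  have neg: "?f v \<le> 0" if "\<gamma> \<le> 0" for v
    using mult_nonneg_nonpos[OF less_imp_le[OF pos(1)] that] pos(2)
    by (smt (verit) exp_gt_zero mult_nonneg_nonpos2)
  consider "?f y \<ge> 0" "\<gamma> \<ge> 0" | "\<And>v. y \<le> v \<Longrightarrow> ?f v \<le> 0"
    using mono[of y] neg by (smt (verit))
  then show ?thesis
  proof cases
    case 1
    then have "?f v \<ge> 0" if "v \<le> y" for v using mono[of v y] that by linarith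
    then have "gap_source x \<le> gap_source y"
      using assms by (intro DERIV_nonneg_imp_nondecreasing[of x y gap_source]) (blast intro: gap_source_deriv)+
    then show ?thesis by simp
  next
    case 2
    then have "gap_source z \<le> gap_source y"
      using assms by (intro DERIV_nonpos_imp_nonincreasing[of y z gap_source]) (blast intro: gap_source_deriv)+
    then show ?thesis by simp
  qed
qed

text \<open>
  Multiplied by the integrating factors \<open>e\<^bsup>(\<delta>+\<lambda>)x/S\<^esup>\<close> and \<open>e\<^bsup>\<delta>x/S\<^esup>\<close>, the gaps below and
  above the threshold have derivatives that are positive multiples of the same source.
\<close>

lemma xbar_is_crossing:
  shows gap_source_xbar: "gap_source xbar \<ge> 0"
    and replenish_value_le_lower: "0 \<le> x \<Longrightarrow> x \<le> xbar \<Longrightarrow> replenish_value x \<le> lower x"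
    and upper_le_replenish_value: "xbar \<le> x \<Longrightarrow> x \<le> 1 \<Longrightarrow> upper x \<le> replenish_value x"
proof -
  define p where "p x = exp ((\<delta> + lam) / S * x) / S" for x
  define q where "q x = exp (\<delta> / S * x) / S" for x
  define U where "U x = exp ((\<delta> + lam) / S * x) * (replenish_value x - lower x)" for x
  define V where "V x = exp (\<delta> / S * x) * (replenish_value x - upper x)" for x
  have U': "(U has_real_derivative p x * gap_source x) (at x)" for x
  proof -
    have "(U has_real_derivative exp ((\<delta> + lam) / S * x) *
        ((\<delta> + lam) / S * (replenish_value x - lower x) + (replenish_value' x - lower' x))) (at x)"
      unfolding U_def[abs_def] by (intro exp_mult_deriv DERIV_diff replenish_value_deriv lower_deriv)
    moreover have "(\<delta> + lam) / S * (replenish_value x - lower x) + (replenish_value' x - lower' x) = gap_source x / S"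
      using lower_ode[of x] S by (simp add: gap_source_def field_simps)
    ultimately show ?thesis by (simp add: p_def)
  qed
  have V': "(V has_real_derivative q x * gap_source x) (at x)" for x
  proof -
    have "(V has_real_derivative exp (\<delta> / S * x) *
        (\<delta> / S * (replenish_value x - upper x) + (replenish_value' x - - \<delta> / S * upper x))) (at x)"
      unfolding V_def[abs_def] by (intro exp_mult_deriv DERIV_diff replenish_value_deriv upper_deriv)
    moreover have "\<delta> / S * (replenish_value x - upper x) + (replenish_value' x - - \<delta> / S * upper x) = gap_source x / S"
      using S by (simp add: gap_source_def field_simps)
    ultimately show ?thesis by (simp add: q_def)
  qed
  have "(\<delta> + lam) * U 0 = gap_source 0"
    using lower_0 by (simp add: U_def gap_source_0 algebra_simps)
  then have U0: "U 0 = 1 / (\<delta> + lam) * gap_source 0" using \<delta> lam by (simp add: field_simps)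
  have V1: "V 1 > 0" if "gap_source 1 \<le> 0"
  proof -
    have "replenish_value 1 - K > 0" using that d mu_pos by (simp add: gap_source_1 mult_le_0_iff)
    then show ?thesis by (simp add: V_def upper_def)
  qed
  note crossing = single_crossing[of gap_source U p V q xbar "1 / (\<delta> + lam)",
      OF gap_source_quasiconcave U' _ V' _ xbar U0 _ _ _ V1]
  have side: "p x > 0" "q x > 0" "1 / (\<delta> + lam) > 0" "U xbar = 0" "V xbar = 0" for x
    using S \<delta> lam by (auto simp: p_def q_def U_def V_def replenish_value_xbar lower_upper_xbar)
  show "gap_source xbar \<ge> 0" by (rule crossing) (auto simp: side[simplified])
  show "replenish_value x \<le> lower x" if "0 \<le> x" "x \<le> xbar"
  proof -
    have "U x \<le> 0" by (rule crossing) (auto simp: side[simplified] that)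
    then show ?thesis by (simp add: U_def mult_le_0_iff)
  qed
  show "upper x \<le> replenish_value x" if "xbar \<le> x" "x \<le> 1"
  proof -
    have "V x \<ge> 0" by (rule crossing) (auto simp: side[simplified] that)
    then show ?thesis by (simp add: V_def zero_le_mult_iff)
  qed
qed

text \<open>
  A negative \<open>\<gamma>\<close> would make the source strictly decreasing. As it is nonnegative at \<open>xbar\<close>, it would be
  positive at \<open>0\<close>; but its value there is a positive multiple of the gap at \<open>0\<close>, which is at most \<open>0\<close>.
\<close>

lemma \<gamma>_nonneg: "\<gamma> \<ge> 0"
proof (rule ccontr)
  assume neg: "\<not> \<gamma> \<ge> 0"
  have "gap_source xbar < gap_source 0"
  proof (rule DERIV_neg_imp_decreasing[OF xbar(1)])
    fix x
    have "mu * (\<delta> + mu) / S > 0" using S \<delta> mu_pos by simp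
    then have "mu * (\<delta> + mu) / S * \<gamma> < 0" using neg by (intro mult_pos_neg) auto
    moreover have "\<delta> * c * \<beta> > 0" using \<delta> c \<beta>_pos by simp
    ultimately have "mu * (\<delta> + mu) / S * \<gamma> * exp (- (\<delta> + mu) / S * x) - \<delta> * c * \<beta> < 0"
      by (smt (verit) exp_gt_zero mult_neg_pos)
    with gap_source_deriv show "\<exists>D. (gap_source has_real_derivative D) (at x) \<and> D < 0" by blast
  qed
  then have "gap_source 0 > 0" using gap_source_xbar by simp
  moreover have "(\<delta> + lam) * replenish_value 0 \<le> (\<delta> + lam) * lower 0"
    using replenish_value_le_lower[of 0] xbar \<delta> lam by simp
  ultimately show False using lower_0 by (simp add: gap_source_0 algebra_simps)
qed

lemma replenish_value_antimono: assumes "x \<le> y" shows "replenish_value y \<le> replenish_value x"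
proof (rule DERIV_nonpos_imp_nonincreasing[OF assms])
  fix z
  have "(\<delta> + mu) / S * \<gamma> * exp (- (\<delta> + mu) / S * z) \<ge> 0" "c * \<beta> \<ge> 0"
    using \<gamma>_nonneg S \<delta> mu_pos c \<beta>_pos by auto
  then have "replenish_value' z \<le> 0" by (simp add: replenish_value'_def)
  with replenish_value_deriv show "\<exists>D. (replenish_value has_real_derivative D) (at z) \<and> D \<le> 0" by blast
qed

text \<open>
  \<open>K \<le> replenish_value 1 \<le> replenish_value xbar = K e\<^bsup>\<delta>(1 - xbar)/S\<^esup>\<close>, and the exponential
  exceeds \<open>1\<close>.
\<close>

lemma K_nonneg: "K \<ge> 0"
proof -
  have "K \<le> replenish_value 1" using upper_le_replenish_value[of 1] xbar by (simp add: upper_def)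
  also have "\<dots> \<le> K * exp (\<delta> / S * (1 - xbar))"
    using replenish_value_antimono[of xbar 1] xbar replenish_value_xbar by (simp add: upper_def)
  finally have "0 \<le> K * (exp (\<delta> / S * (1 - xbar)) - 1)" by (simp add: algebra_simps)
  moreover have "exp (\<delta> / S * (1 - xbar)) - 1 > 0" using S \<delta> xbar by simp
  ultimately show ?thesis by (simp add: zero_le_mult_iff)
qed

lemma replenish_value_nonneg: "x \<le> 1 \<Longrightarrow> replenish_value x \<ge> 0"
  using upper_le_replenish_value[of 1] xbar K_nonneg replenish_value_antimono[of x 1] by (simp add: upper_def)

lemma candidate_nonneg: "0 \<le> x \<Longrightarrow> x \<le> 1 \<Longrightarrow> candidate x \<ge> 0"
  using replenish_value_le_lower[of x] replenish_value_nonneg[of x] K_nonneg by (auto simp: candidate_def upper_def)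

lemma obs_value_nonneg: "0 \<le> x \<Longrightarrow> x \<le> 1 \<Longrightarrow> obs_value x \<ge> 0"
  using replenish_value_nonneg candidate_nonneg by (simp add: obs_value_def)

lemma obs_value_le: assumes "0 \<le> x" "x \<le> 1" shows "obs_value x \<le> replenish_value x" "obs_value x \<le> candidate x"
  using assms replenish_value_le_lower[of x] upper_le_replenish_value[of x] by (auto simp: obs_value_def candidate_def)

lemma candidate_ode: "S * candidate' x + (\<delta> + lam) * candidate x = lam * obs_value x"
  using lower_ode[of x] S by (simp add: candidate'_def candidate_def obs_value_def algebra_simps)

lemma candidate_0: "(\<delta> + lam) * candidate 0 = 1 + lam * obs_value 0"
  using lower_0 xbar by (simp add: candidate_def obs_value_def)

lemma candidate_1: "candidate 1 = K"
  using xbar by (simp add: candidate_def upper_def)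

lemma candidate_bounded: "\<exists>b. \<forall>x\<in>{0..1}. candidate x \<le> b"
proof -
  have "compact (candidate ` {0..1})"
    by (intro compact_continuous_image continuous_at_imp_continuous_on ballI DERIV_isCont[OF candidate_deriv]) simp
  from compact_imp_bounded[OF this] show ?thesis
    unfolding bounded_iff by (force intro: abs_le_D1)
qed

lemma borel_measurable_candidate [measurable]:
  "replenish_value \<in> borel_measurable borel" "candidate \<in> borel_measurable borel" "obs_value \<in> borel_measurable borel"
proof -
  show *: "replenish_value \<in> borel_measurable borel"
    by (intro borel_measurable_continuous_onI continuous_at_imp_continuous_on ballI DERIV_isCont[OF replenish_value_deriv])
  show **: "candidate \<in> borel_measurable borel"
    by (intro borel_measurable_continuous_onI continuous_at_imp_continuous_on ballI DERIV_isCont[OF candidate_deriv])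
  show "obs_value \<in> borel_measurable borel"
    unfolding obs_value_def[abs_def] using * ** by measurable
qed

end

section \<open>Information and independence\<close>

locale exponential_clock =
  fixes M :: "'w measure" and lam mu :: real and W om :: "nat \<Rightarrow> 'w \<Rightarrow> real"
  assumes times: "exponential_times M lam mu W om" and rates: "lam > 0" "mu > 0"

sublocale exponential_clock \<subseteq> prob_space M
  using times by (simp add: exponential_times_def)

context exponential_clock
begin

abbreviation clock :: "nat + nat \<Rightarrow> 'w \<Rightarrow> real" where
  "clock \<equiv> case_sum W om"

text \<open>
  Waiting times and delays are merged into one independent family indexed by a disjoint sum; an index
  set then describes which clocks have been revealed.
\<close>

definition hist :: "(nat + nat) set \<Rightarrow> 'w measure" where
  "hist I = sigma (space M) (\<Union>i\<in>I. {clock i -` E \<inter> space M | E. E \<in> sets borel})"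

lemma space_hist [simp]: "space (hist I) = space M"
  by (auto simp: hist_def intro!: space_measure_of)

lemma sets_hist: "sets (hist I) = sigma_sets (space M) (\<Union>i\<in>I. {clock i -` E \<inter> space M | E. E \<in> sets borel})"
  by (auto simp: hist_def intro!: sets_measure_of)

lemma measurable_hist_mono:
  assumes "f \<in> hist I \<rightarrow>\<^sub>M N" "I \<subseteq> J" shows "f \<in> hist J \<rightarrow>\<^sub>M N"
proof -
  have "sets (hist I) \<subseteq> sets (hist J)"
    unfolding sets_hist using assms(2) by (intro sigma_sets_mono') blast
  then show ?thesis using assms(1) unfolding measurable_def by auto
qed

lemma clock_measurable_hist: "i \<in> I \<Longrightarrow> clock i \<in> borel_measurable (hist I)"
  unfolding measurable_def by (auto simp: sets_hist intro!: sigma_sets.Basic)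

lemma clock_measurable: "i \<in> {1..} <+> {1..} \<Longrightarrow> clock i \<in> borel_measurable M"
  using times unfolding exponential_times_def indep_vars_def by blast

lemma measurable_from_hist:
  assumes "f \<in> hist I \<rightarrow>\<^sub>M N" "I \<subseteq> {1..} <+> {1..}" shows "f \<in> M \<rightarrow>\<^sub>M N"
proof -
  have "sigma_sets (space M) (\<Union>i\<in>I. {clock i -` E \<inter> space M | E. E \<in> sets borel}) \<subseteq> sets M"
    using assms(2) clock_measurable by (intro sets.sigma_sets_subset) (auto dest: measurable_sets)
  then show ?thesis using assms(1) unfolding measurable_def by (auto simp: sets_hist)
qed

text \<open>
  Independence in the form needed for Fubini's theorem. It extends from the events of single clocks to
  the \<open>\<sigma>\<close>-algebra generated by all revealed ones.
\<close>

lemma joint_law_fresh_clock: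
  assumes Z: "Z \<in> hist I \<rightarrow>\<^sub>M N" and I: "I \<subseteq> {1..} <+> {1..}" and j: "j \<in> {1..} <+> {1..}" "j \<notin> I"
  shows "distr M N Z \<Otimes>\<^sub>M distr M borel (clock j) = distr M (N \<Otimes>\<^sub>M borel) (\<lambda>w. (Z w, clock j w))"
proof -
  let ?E = "\<lambda>i. {clock i -` E \<inter> space M | E. E \<in> sets borel}"
  have "indep_sets (\<lambda>b. sigma_sets (space M) (\<Union>i\<in>case_bool I {j} b. ?E i)) UNIV"
  proof (rule indep_sets_collect_sigma)
    have "indep_sets ?E ({1..} <+> {1..})"
      using times unfolding exponential_times_def indep_vars_def2 by blast
    then show "indep_sets ?E (\<Union>b\<in>UNIV. case_bool I {j} b)"
      by (rule indep_sets_mono_index[rotated]) (use I j in \<open>auto split: bool.splits\<close>)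
    show "Int_stable (?E i)" for i
    proof (rule Int_stableI)
      fix a b assume "a \<in> ?E i" "b \<in> ?E i"
      then obtain A B where "a = clock i -` A \<inter> space M" "b = clock i -` B \<inter> space M" "A \<in> sets borel" "B \<in> sets borel"
        by blast
      then have "a \<inter> b = clock i -` (A \<inter> B) \<inter> space M" "A \<inter> B \<in> sets borel" by auto
      then show "a \<inter> b \<in> ?E i" by blast
    qed
    show "disjoint_family_on (case_bool I {j}) UNIV"
      using j by (auto simp: disjoint_family_on_def split: bool.splits)
  qed
  moreover have "(\<lambda>b. sigma_sets (space M) (\<Union>i\<in>case_bool I {j} b. ?E i))
      = case_bool (sets (hist I)) (sigma_sets (space M) (?E j))"
    by (auto simp: sets_hist fun_eq_iff split: bool.splits)
  ultimately have indep: "indep_set (sets (hist I)) (sigma_sets (space M) (?E j))"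
    by (simp add: indep_set_def)
  have meas [measurable]: "Z \<in> M \<rightarrow>\<^sub>M N" "clock j \<in> borel_measurable M"
    using measurable_from_hist[OF Z I] clock_measurable[OF j(1)] by auto
  interpret ZN: prob_space "distr M N Z" by (rule prob_space_distr) simp
  interpret V: prob_space "distr M borel (clock j)" by (rule prob_space_distr) simp
  show ?thesis
  proof (rule pair_measure_eqI)
    fix A B assume A: "A \<in> sets (distr M N Z)" and B: "B \<in> sets (distr M borel (clock j))"
    have "Z -` A \<inter> space M \<in> sets (hist I)" using measurable_sets[OF Z, of A] A by simp
    moreover have "clock j -` B \<inter> space M \<in> sigma_sets (space M) (?E j)"
      using B by (intro sigma_sets.Basic) auto
    ultimately have "prob ((Z -` A \<inter> space M) \<inter> (clock j -` B \<inter> space M))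
        = prob (Z -` A \<inter> space M) * prob (clock j -` B \<inter> space M)"
      by (rule indep_setD[OF indep])
    moreover have "(\<lambda>w. (Z w, clock j w)) -` (A \<times> B) \<inter> space M = (Z -` A \<inter> space M) \<inter> (clock j -` B \<inter> space M)"
      by auto
    ultimately show "emeasure (distr M N Z) A * emeasure (distr M borel (clock j)) B
        = emeasure (distr M (N \<Otimes>\<^sub>M borel) (\<lambda>w. (Z w, clock j w))) (A \<times> B)"
      using A B by (simp add: emeasure_distr emeasure_eq_measure ennreal_mult' mult.commute)
  qed (simp_all add: ZN.sigma_finite_measure_axioms V.sigma_finite_measure_axioms cong: sets_pair_measure_cong)
qed

lemma clock_distributed:
  assumes "j \<in> {1..} <+> {1..}"
  shows "distributed M lborel (clock j) (exponential_density (case_sum (\<lambda>_. lam) (\<lambda>_. mu) j))"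
  using times assms unfolding exponential_times_def by auto

text \<open>
  A clock that has not been revealed can be integrated out against its density with everything
  revealed held fixed.
\<close>

lemma nn_integral_fresh_clock:
  assumes Z: "Z \<in> hist I \<rightarrow>\<^sub>M N" and I: "I \<subseteq> {1..} <+> {1..}" and j: "j \<in> {1..} <+> {1..}" "j \<notin> I"
    and F [measurable]: "F \<in> borel_measurable (N \<Otimes>\<^sub>M borel)"
  shows "(\<integral>\<^sup>+ w. F (Z w, clock j w) \<partial>M)
    = (\<integral>\<^sup>+ w. (\<integral>\<^sup>+ t. ennreal (exponential_density (case_sum (\<lambda>_. lam) (\<lambda>_. mu) j) t) * F (Z w, t) \<partial>lborel) \<partial>M)"
proof -
  let ?f = "exponential_density (case_sum (\<lambda>_. lam) (\<lambda>_. mu) j)"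
  have [measurable]: "Z \<in> M \<rightarrow>\<^sub>M N" "clock j \<in> borel_measurable M"
    using measurable_from_hist[OF Z I] clock_measurable[OF j(1)] by auto
  have law: "distr M borel (clock j) = density lborel ?f"
    using distributed_distr_eq_density[OF clock_distributed[OF j(1)]] by (simp cong: distr_cong)
  have joint: "distr M N Z \<Otimes>\<^sub>M distr M borel (clock j) = distr M (N \<Otimes>\<^sub>M borel) (\<lambda>w. (Z w, clock j w))"
    by (rule joint_law_fresh_clock[OF Z I j])
  interpret D: prob_space "distr M borel (clock j)" by (rule prob_space_distr) simp
  have "(\<integral>\<^sup>+ w. F (Z w, clock j w) \<partial>M) = (\<integral>\<^sup>+ p. F p \<partial>(distr M N Z \<Otimes>\<^sub>M distr M borel (clock j)))"
    unfolding joint by (subst nn_integral_distr) simp_all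
  also have "\<dots> = (\<integral>\<^sup>+ z. (\<integral>\<^sup>+ t. F (z, t) \<partial>distr M borel (clock j)) \<partial>distr M N Z)"
    by (subst D.nn_integral_fst[symmetric]) (simp_all cong: measurable_cong_sets)
  also have "\<dots> = (\<integral>\<^sup>+ w. (\<integral>\<^sup>+ t. F (Z w, t) \<partial>distr M borel (clock j)) \<partial>M)"
    by (subst nn_integral_distr) (auto intro!: D.borel_measurable_nn_integral simp: case_prod_beta cong: measurable_cong_sets)
  also have "\<dots> = (\<integral>\<^sup>+ w. (\<integral>\<^sup>+ t. ennreal (?f t) * F (Z w, t) \<partial>lborel) \<partial>M)"
  proof (rule nn_integral_cong)
    fix w assume "w \<in> space M"
    then have [measurable]: "Z w \<in> space N" using measurable_space[OF \<open>Z \<in> M \<rightarrow>\<^sub>M N\<close>] by blast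
    show "(\<integral>\<^sup>+ t. F (Z w, t) \<partial>distr M borel (clock j)) = (\<integral>\<^sup>+ t. ennreal (?f t) * F (Z w, t) \<partial>lborel)"
      unfolding law by (subst nn_integral_density) simp_all
  qed
  finally show ?thesis .
qed

lemma AE_clock_pos:
  assumes "j \<in> {1..} <+> {1..}" shows "AE w in M. clock j w > 0"
proof -
  have "AE t in lborel. 0 < ennreal (exponential_density (case_sum (\<lambda>_. lam) (\<lambda>_. mu) j) t) \<longrightarrow> t > 0"
    using AE_lborel_singleton[of "0::real"]
    by eventually_elim (auto simp: exponential_density_def split: if_splits)
  then show ?thesis
    by (subst distributed_AE2[OF clock_distributed[OF assms]]) auto
qed

lemma AE_times_pos: "AE w in M. \<forall>k\<ge>1. W k w > 0 \<and> om k w > 0"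
  using AE_clock_pos[of "Inl _"] AE_clock_pos[of "Inr _"] by (auto simp: AE_all_countable)

end

locale controlled_process = exponential_clock M lam mu W om
  for M :: "'w measure" and lam mu :: real and W om :: "nat \<Rightarrow> 'w \<Rightarrow> real" +
  fixes S x :: real and \<theta> :: "nat \<Rightarrow> 'w \<Rightarrow> bool"
  assumes S_pos: "S > 0" and x01: "x \<in> {0..1}" and adm: "\<theta> \<in> admissible M S W om x"
begin

abbreviation T where "T k w \<equiv> exec_time (\<lambda>i. W i w) (\<lambda>i. om i w) (\<lambda>i. \<theta> i w) k"
abbreviation Y where "Y k w \<equiv> post_state S x (\<lambda>i. W i w) (\<lambda>i. om i w) (\<lambda>i. \<theta> i w) k"
abbreviation Tobs where "Tobs k w \<equiv> obs_time (\<lambda>i. W i w) (\<lambda>i. om i w) (\<lambda>i. \<theta> i w) k"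
abbreviation Z where "Z k w \<equiv> obs_state S x (\<lambda>i. W i w) (\<lambda>i. om i w) (\<lambda>i. \<theta> i w) k"
abbreviation Ypre where "Ypre k w \<equiv> pre_state S x (\<lambda>i. W i w) (\<lambda>i. om i w) (\<lambda>i. \<theta> i w) k"

text \<open>
  The clocks revealed at the \<open>k\<close>-th execution time, and at observation \<open>k + 1\<close>: the latter has seen
  one more waiting time but not the delay that its decision may trigger.
\<close>

definition past :: "nat \<Rightarrow> (nat + nat) set" where "past k = {1..k} <+> {1..k}"
definition seen :: "nat \<Rightarrow> (nat + nat) set" where "seen k = {1..Suc k} <+> {1..k}"

lemma past_seen: "past k \<subseteq> seen k" "seen k \<subseteq> past (Suc k)" "j \<le> k \<Longrightarrow> past j \<subseteq> past k"
    "past k \<subseteq> {1..} <+> {1..}" "seen k \<subseteq> {1..} <+> {1..}"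
  by (auto simp: past_def seen_def)

lemma theta_0: "w \<in> space M \<Longrightarrow> \<not> \<theta> 0 w"
  using adm by (simp add: admissible_def)

lemma T_Suc: "T (Suc k) w = Tobs (Suc k) w + (if \<theta> (Suc k) w then om (Suc k) w else 0)"
  and Tobs_Suc: "Tobs (Suc k) w = T k w + W (Suc k) w"
  and Z_Suc: "Z (Suc k) w = deplete S (Y k w) (W (Suc k) w)"
  by (simp_all add: exec_time_def exec_delay_def obs_state_def)

text \<open>
  The \<open>\<sigma>\<close>-algebra \<open>info\<close> is generated by times and states that depend on earlier decisions, while those
  are measurable with respect to earlier \<open>info\<close>. Induction on the observation number resolves this
  circle: all of it depends on the clocks revealed so far only.
\<close>

lemma measurable_process:
  shows "T k \<in> borel_measurable (hist (past k))" "Y k \<in> borel_measurable (hist (past k))"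
    "Tobs (Suc k) \<in> borel_measurable (hist (seen k))" "Z (Suc k) \<in> borel_measurable (hist (seen k))"
    "\<theta> (Suc k) \<in> hist (seen k) \<rightarrow>\<^sub>M count_space UNIV"
proof -
  have obs_step: "Tobs (Suc k) \<in> borel_measurable (hist (seen k))" "Z (Suc k) \<in> borel_measurable (hist (seen k))"
    if "T k \<in> borel_measurable (hist (past k))" "Y k \<in> borel_measurable (hist (past k))" for k
  proof -
    have [measurable]: "T k \<in> borel_measurable (hist (seen k))" "Y k \<in> borel_measurable (hist (seen k))"
      using that[THEN measurable_hist_mono, OF past_seen(1)] by simp_all
    have [measurable]: "W (Suc k) \<in> borel_measurable (hist (seen k))"
      using clock_measurable_hist[of "Inl (Suc k)" "seen k"] by (simp add: seen_def InlI)
    show "Tobs (Suc k) \<in> borel_measurable (hist (seen k))" "Z (Suc k) \<in> borel_measurable (hist (seen k))"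
      unfolding Tobs_Suc Z_Suc by measurable
  qed
  have "(\<forall>j\<le>k. T j \<in> borel_measurable (hist (past j)) \<and> Y j \<in> borel_measurable (hist (past j))
      \<and> Tobs j \<in> borel_measurable (hist (past j)) \<and> Z j \<in> borel_measurable (hist (past j))
      \<and> Ypre j \<in> borel_measurable (hist (past j)))
      \<and> (\<forall>j<k. \<theta> (Suc j) \<in> hist (seen j) \<rightarrow>\<^sub>M count_space UNIV)" for k
  proof (induction k)
    case 0
    have "T 0 \<in> borel_measurable (hist (past 0)) \<longleftrightarrow> (\<lambda>_. 0 :: real) \<in> borel_measurable (hist (past 0))"
      by (rule measurable_cong) (simp add: exec_time_def exec_delay_def theta_0)
    then show ?case by (simp add: obs_state_def pre_state_def)
  next
    case (Suc k)
    have obs: "Tobs (Suc k) \<in> borel_measurable (hist (seen k))" "Z (Suc k) \<in> borel_measurable (hist (seen k))"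
      using obs_step Suc by auto
    have obs_j: "Tobs j \<in> borel_measurable (hist (seen k))" "Z j \<in> borel_measurable (hist (seen k))"
      if "j \<le> Suc k" for j
    proof -
      consider "j = Suc k" | "j \<le> k" using \<open>j \<le> Suc k\<close> le_Suc_eq by blast
      then have "Tobs j \<in> borel_measurable (hist (seen k)) \<and> Z j \<in> borel_measurable (hist (seen k))"
      proof cases
        case 2
        then have "past j \<subseteq> seen k" using past_seen by blast
        with 2 Suc show ?thesis using measurable_hist_mono[of _ "past j" _ "seen k"] by blast
      qed (use obs in simp)
      then show "Tobs j \<in> borel_measurable (hist (seen k))" "Z j \<in> borel_measurable (hist (seen k))" by auto
    qed
    have exe_j: "T j \<in> borel_measurable (hist (seen k))" "Ypre j \<in> borel_measurable (hist (seen k))"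
      if "j < Suc k" for j
    proof -
      have "j \<le> k" using that by simp
      moreover have "past j \<subseteq> seen k" using past_seen \<open>j \<le> k\<close> by blast
      ultimately show "T j \<in> borel_measurable (hist (seen k))" "Ypre j \<in> borel_measurable (hist (seen k))"
        using Suc measurable_hist_mono[of _ "past j" _ "seen k"] by blast+
    qed
    have info: "sets (info M S W om x \<theta> (Suc k)) \<subseteq> sets (hist (seen k))"
    proof -
      have "(\<lambda>w. (Tobs j w, Z j w)) -` E \<inter> space M \<in> sets (hist (seen k))"
        if "j \<le> Suc k" "E \<in> sets borel" for j E
        using measurable_sets[OF borel_measurable_Pair[OF obs_j[OF that(1)]] that(2)] by simp
      moreover have "(\<lambda>w. (T j w, Ypre j w)) -` E \<inter> space M \<in> sets (hist (seen k))"
        if "j < Suc k" "E \<in> sets borel" for j E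
        using measurable_sets[OF borel_measurable_Pair[OF exe_j[OF that(1)]] that(2)] by simp
      ultimately have "sigma_sets (space (hist (seen k)))
          ((\<Union>j\<in>{..Suc k}. {(\<lambda>w. (Tobs j w, Z j w)) -` E \<inter> space M | E. E \<in> sets borel})
            \<union> (\<Union>j\<in>{..<Suc k}. {(\<lambda>w. (T j w, Ypre j w)) -` E \<inter> space M | E. E \<in> sets borel})) \<subseteq> sets (hist (seen k))"
        by (intro sets.sigma_sets_subset) auto
      then show ?thesis
        unfolding info_def Let_def by (subst sets_measure_of) auto
    qed
    have "\<theta> (Suc k) \<in> info M S W om x \<theta> (Suc k) \<rightarrow>\<^sub>M count_space UNIV"
      using adm by (simp add: admissible_def)
    moreover have "space (info M S W om x \<theta> (Suc k)) = space M"
      unfolding info_def Let_def by (rule space_measure_of) auto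
    ultimately have \<theta>: "\<theta> (Suc k) \<in> hist (seen k) \<rightarrow>\<^sub>M count_space UNIV"
      using info unfolding measurable_def by auto
    have [measurable]: "\<theta> (Suc k) \<in> hist (past (Suc k)) \<rightarrow>\<^sub>M count_space UNIV"
      "Tobs (Suc k) \<in> borel_measurable (hist (past (Suc k)))" "Z (Suc k) \<in> borel_measurable (hist (past (Suc k)))"
      using \<theta> obs by (auto intro: measurable_hist_mono[OF _ past_seen(2)])
    have [measurable]: "om (Suc k) \<in> borel_measurable (hist (past (Suc k)))" "W (Suc k) \<in> borel_measurable (hist (past (Suc k)))"
      using clock_measurable_hist[of "Inr (Suc k)" "past (Suc k)"] clock_measurable_hist[of "Inl (Suc k)" "past (Suc k)"]
      by (simp_all add: past_def InlI InrI)
    have [measurable]: "Y k \<in> borel_measurable (hist (past (Suc k)))"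
      using Suc by (auto intro: measurable_hist_mono[OF _ past_seen(3)])
    have "T (Suc k) \<in> borel_measurable (hist (past (Suc k)))"
      unfolding T_Suc by measurable
    moreover have "Y (Suc k) \<in> borel_measurable (hist (past (Suc k)))"
      "Ypre (Suc k) \<in> borel_measurable (hist (past (Suc k)))"
      unfolding post_state.simps pre_state_def nat.case exec_delay_def by measurable
    moreover have "Tobs (Suc k) \<in> borel_measurable (hist (past (Suc k)))"
      "Z (Suc k) \<in> borel_measurable (hist (past (Suc k)))" by measurable
    ultimately show ?case
      using Suc \<theta> by (auto simp: le_Suc_eq less_Suc_eq simp del: obs_time.simps post_state.simps)
  qed
  from this[of "Suc k"] show "T k \<in> borel_measurable (hist (past k))" "Y k \<in> borel_measurable (hist (past k))"
    "\<theta> (Suc k) \<in> hist (seen k) \<rightarrow>\<^sub>M count_space UNIV" by auto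
  then show "Tobs (Suc k) \<in> borel_measurable (hist (seen k))" "Z (Suc k) \<in> borel_measurable (hist (seen k))"
    using obs_step by auto
qed

end

lemma nn_integral_add3:
  assumes "f \<in> borel_measurable M" "g \<in> borel_measurable M" "h \<in> borel_measurable M"
  shows "(\<integral>\<^sup>+ w. f w + g w + h w \<partial>M) = (\<integral>\<^sup>+ w. f w \<partial>M) + (\<integral>\<^sup>+ w. g w \<partial>M) + (\<integral>\<^sup>+ w. h w \<partial>M)"
  using assms by (simp add: nn_integral_add)

context controlled_process
begin

lemma measurable_process_M [measurable]:
  "T k \<in> borel_measurable M" "Y k \<in> borel_measurable M"
  "Tobs (Suc k) \<in> borel_measurable M" "Z (Suc k) \<in> borel_measurable M"
  "\<theta> (Suc k) \<in> M \<rightarrow>\<^sub>M count_space UNIV"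
  "W (Suc k) \<in> borel_measurable M" "om (Suc k) \<in> borel_measurable M"
proof -
  show "T k \<in> borel_measurable M" "Y k \<in> borel_measurable M"
    using measurable_from_hist past_seen(4) measurable_process(1,2) by blast+
  show "Tobs (Suc k) \<in> borel_measurable M" "Z (Suc k) \<in> borel_measurable M"
    "\<theta> (Suc k) \<in> M \<rightarrow>\<^sub>M count_space UNIV"
    using measurable_from_hist past_seen(5) measurable_process(3-5) by blast+
  show "W (Suc k) \<in> borel_measurable M" "om (Suc k) \<in> borel_measurable M"
    using clock_measurable[of "Inl (Suc k)"] clock_measurable[of "Inr (Suc k)"] by (auto simp: InlI InrI)
qed

lemma nn_integral_fresh_W:
  fixes F :: "(real \<times> real) \<times> real \<Rightarrow> ennreal"
  assumes "F \<in> borel_measurable ((borel \<Otimes>\<^sub>M borel) \<Otimes>\<^sub>M borel)"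
  shows "(\<integral>\<^sup>+ w. F ((T k w, Y k w), W (Suc k) w) \<partial>M)
    = (\<integral>\<^sup>+ w. (\<integral>\<^sup>+ t. ennreal (exponential_density lam t) * F ((T k w, Y k w), t) \<partial>lborel) \<partial>M)"
proof -
  have joint: "(\<lambda>w. (T k w, Y k w)) \<in> hist (past k) \<rightarrow>\<^sub>M borel \<Otimes>\<^sub>M borel"
    by (intro measurable_Pair measurable_process)
  have fresh: "Inl (Suc k) \<in> {1..} <+> {1..}" "Inl (Suc k) \<notin> past k" by (auto simp: past_def)
  show ?thesis using nn_integral_fresh_clock[OF joint past_seen(4) fresh assms] by simp
qed

text \<open>
  The weight \<open>a\<close> may carry the decision itself, which is revealed together with the observation.
\<close>

lemma nn_integral_fresh_om:
  fixes F :: "(real \<times> real) \<times> real \<Rightarrow> ennreal"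
  assumes "F \<in> borel_measurable ((borel \<Otimes>\<^sub>M borel) \<Otimes>\<^sub>M borel)" and a: "a \<in> borel_measurable (hist (seen k))"
  shows "(\<integral>\<^sup>+ w. F ((a w, Z (Suc k) w), om (Suc k) w) \<partial>M)
    = (\<integral>\<^sup>+ w. (\<integral>\<^sup>+ t. ennreal (exponential_density mu t) * F ((a w, Z (Suc k) w), t) \<partial>lborel) \<partial>M)"
proof -
  have joint: "(\<lambda>w. (a w, Z (Suc k) w)) \<in> hist (seen k) \<rightarrow>\<^sub>M borel \<Otimes>\<^sub>M borel"
    by (intro measurable_Pair measurable_process a)
  have fresh: "Inr (Suc k) \<in> {1..} <+> {1..}" "Inr (Suc k) \<notin> seen k" by (auto simp: seen_def)
  show ?thesis using nn_integral_fresh_clock[OF joint past_seen(5) fresh assms(1)] by simp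
qed

text \<open>
  A cycle is at least as long as its waiting time, whose discount factor has expectation
  \<open>lam / (\<delta> + lam)\<close> and is independent of the past.
\<close>

lemma expected_discount_le:
  assumes "\<delta> > 0"
  shows "(\<integral>\<^sup>+ w. ennreal (exp (- \<delta> * T k w)) \<partial>M) \<le> ennreal ((lam / (\<delta> + lam)) ^ k)"
proof (induction k)
  case 0
  have "(\<integral>\<^sup>+ w. ennreal (exp (- \<delta> * T 0 w)) \<partial>M) = (\<integral>\<^sup>+ w. 1 \<partial>M)"
    by (intro nn_integral_cong) (simp add: exec_time_def exec_delay_def theta_0)
  then show ?case by (simp add: emeasure_space_1)
next
  case (Suc k)
  have "(\<integral>\<^sup>+ w. ennreal (exp (- \<delta> * T (Suc k) w)) \<partial>M)
      \<le> (\<integral>\<^sup>+ w. ennreal (exp (- \<delta> * T k w)) * ennreal (exp (- \<delta> * W (Suc k) w)) \<partial>M)"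
  proof (rule nn_integral_mono_AE)
    show "AE w in M. ennreal (exp (- \<delta> * T (Suc k) w))
        \<le> ennreal (exp (- \<delta> * T k w)) * ennreal (exp (- \<delta> * W (Suc k) w))"
      using AE_times_pos
    proof eventually_elim
      fix w assume "\<forall>k\<ge>1. W k w > 0 \<and> om k w > 0"
      then have "om (Suc k) w \<ge> 0" by (simp add: less_imp_le)
      then have "T k w + W (Suc k) w \<le> T (Suc k) w" unfolding T_Suc Tobs_Suc by simp
      then show "ennreal (exp (- \<delta> * T (Suc k) w))
        \<le> ennreal (exp (- \<delta> * T k w)) * ennreal (exp (- \<delta> * W (Suc k) w))"
        using assms by (simp add: ennreal_mult'[symmetric] mult_exp_exp ennreal_leI distrib_left[symmetric]
            flip: minus_add_distrib del: exec_time_def)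
          (smt (verit) distrib_left mult_left_mono)
    qed
  qed
  also have "\<dots> = (\<integral>\<^sup>+ w. (\<integral>\<^sup>+ t. ennreal (exponential_density lam t)
      * (ennreal (exp (- \<delta> * T k w)) * ennreal (exp (- \<delta> * t))) \<partial>lborel) \<partial>M)"
    using nn_integral_fresh_W[of "\<lambda>p. ennreal (exp (- \<delta> * fst (fst p))) * ennreal (exp (- \<delta> * snd p))" k] by simp
  also have "\<dots> = (\<integral>\<^sup>+ w. ennreal (exp (- \<delta> * T k w)) * ennreal (lam / (\<delta> + lam)) \<partial>M)"
  proof (rule nn_integral_cong)
    fix w
    have "(\<integral>\<^sup>+ t. ennreal (exponential_density lam t) * (ennreal (exp (- \<delta> * T k w)) * ennreal (exp (- \<delta> * t))) \<partial>lborel)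
      = ennreal (exp (- \<delta> * T k w)) * (\<integral>\<^sup>+ t. ennreal (exponential_density lam t) * ennreal (exp (- \<delta> * t)) \<partial>lborel)"
      by (subst nn_integral_cmult[symmetric]) (auto simp: mult_ac)
    then show "(\<integral>\<^sup>+ t. ennreal (exponential_density lam t) * (ennreal (exp (- \<delta> * T k w)) * ennreal (exp (- \<delta> * t))) \<partial>lborel)
      = ennreal (exp (- \<delta> * T k w)) * ennreal (lam / (\<delta> + lam))"
      using nn_integral_exponential_discount[OF assms rates(1)] by simp
  qed
  also have "\<dots> = (\<integral>\<^sup>+ w. ennreal (exp (- \<delta> * T k w)) \<partial>M) * ennreal (lam / (\<delta> + lam))"
    by (rule nn_integral_multc) measurable
  also have "\<dots> \<le> ennreal ((lam / (\<delta> + lam)) ^ k) * ennreal (lam / (\<delta> + lam))"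
    by (intro mult_right_mono Suc) simp
  also have "\<dots> = ennreal ((lam / (\<delta> + lam)) ^ Suc k)"
    using assms rates by (simp add: ennreal_mult'[symmetric] mult.commute)
  finally show ?case .
qed

text \<open>
  With the discount rate \<open>1\<close>, the sum of the discount factors at all execution times has finite
  expectation, so it converges almost surely and the factors tend to \<open>0\<close>.
\<close>

lemma AE_exec_time_unbounded: "AE w in M. \<forall>t. \<exists>k. t \<le> T k w"
proof -
  \<comment> \<open>The geometric rate of \<open>expected_discount_le\<close> for the discount rate \<open>1\<close>.\<close>
  define q where "q = lam / (1 + lam)"
  have q: "0 \<le> q" "q < 1" using rates by (auto simp: q_def)
  have "(\<integral>\<^sup>+ w. (\<Sum>k. ennreal (exp (- 1 * T k w))) \<partial>M) = (\<Sum>k. \<integral>\<^sup>+ w. ennreal (exp (- 1 * T k w)) \<partial>M)"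
    by (rule nn_integral_suminf) measurable
  also have "\<dots> \<le> (\<Sum>k. ennreal (q ^ k))"
    using expected_discount_le[of 1] unfolding q_def by (intro suminf_le summableI) auto
  also have "\<dots> = ennreal (\<Sum>k. q ^ k)"
    using q by (intro suminf_ennreal2 summable_geometric) auto
  also have "\<dots> < \<infinity>" by simp
  finally have "(\<integral>\<^sup>+ w. (\<Sum>k. ennreal (exp (- 1 * T k w))) \<partial>M) \<noteq> \<infinity>" by simp
  then have "AE w in M. (\<Sum>k. ennreal (exp (- 1 * T k w))) \<noteq> \<infinity>"
    by (intro nn_integral_PInf_AE) measurable
  then show ?thesis
  proof eventually_elim
    fix w assume "(\<Sum>k. ennreal (exp (- 1 * T k w))) \<noteq> \<infinity>"
    then have "summable (\<lambda>k. exp (- T k w))" by (intro summable_suminf_not_top) auto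
    then have lim: "(\<lambda>k. exp (- T k w)) \<longlonglongrightarrow> 0" by (rule summable_LIMSEQ_zero)
    show "\<forall>t. \<exists>k. t \<le> T k w"
    proof
      fix t
      have "eventually (\<lambda>k. exp (- T k w) < exp (- t)) sequentially"
        by (rule order_tendstoD(2)[OF lim]) simp
      then obtain k where "exp (- T k w) < exp (- t)" by (auto simp: eventually_sequentially)
      then show "\<exists>k. t \<le> T k w" by (intro exI[of _ k]) simp
    qed
  qed
qed

lemma AE_regular_path:
  "AE w in M. w \<in> space M \<and> (\<forall>k\<ge>1. W k w > 0 \<and> om k w > 0) \<and> (\<forall>t. \<exists>k. t \<le> T k w) \<and> (\<forall>k. Y k w \<in> {0..1})
     \<and> (\<forall>k. Z (Suc k) w \<in> {0..1})"
  using AE_times_pos AE_exec_time_unbounded AE_space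
proof eventually_elim
  fix w assume w: "\<forall>k\<ge>1. W k w > 0 \<and> om k w > 0" "\<forall>t. \<exists>k. t \<le> T k w" "w \<in> space M"
  have Y: "Y k w \<in> {0..1}" for k
    by (rule post_state_bounds[OF S_pos x01]) (use w in auto)
  moreover have "Z (Suc k) w \<in> {0..1}" for k
    using deplete_bounds[of S "Y k w" "W (Suc k) w"] S_pos Y[of k] w(1) less_imp_le[of 0 "W (Suc k) w"] unfolding Z_Suc by fastforce
  ultimately show "w \<in> space M \<and> (\<forall>k\<ge>1. W k w > 0 \<and> om k w > 0) \<and> (\<forall>t. \<exists>k. t \<le> T k w)
      \<and> (\<forall>k. Y k w \<in> {0..1}) \<and> (\<forall>k. Z (Suc k) w \<in> {0..1})"
    using w by blast
qed

end

section \<open>Verification\<close>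

locale verification =
  free_boundary S \<delta> c d lam mu \<alpha> \<beta> \<gamma> B C G K xbar AK +
  controlled_process M lam mu W om S x \<theta>
  for M :: "'w measure" and W om :: "nat \<Rightarrow> 'w \<Rightarrow> real" and S \<delta> c d lam mu \<alpha> \<beta> \<gamma> B C G K xbar AK x :: real
    and \<theta> :: "nat \<Rightarrow> 'w \<Rightarrow> bool"
begin

abbreviation stage where
  "stage k w \<equiv> stage_cost S \<delta> c d x (\<lambda>i. W i w) (\<lambda>i. om i w) (\<lambda>i. \<theta> i w) k"

lemma wait_replenish_value:
  assumes "0 \<le> z" "z \<le> 1"
  shows "(\<integral>\<^sup>+ t. ennreal (exponential_density mu t)
      * ennreal (idle_cost S \<delta> z t + exp (- \<delta> * t) * (c * (1 - deplete S z t) + d + K)) \<partial>lborel) = ennreal (replenish_value z)"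
proof (rule nn_integral_exponential_wait[OF S \<delta> mu_pos assms(1) replenish_value_deriv replenish_value_ode])
  show "(\<delta> + mu) * replenish_value 0 = 1 + mu * (c * (1 - 0) + d + K)" using replenish_value_0 by simp
  show "0 \<le> c * (1 - y) + d + K" if "0 \<le> y" "y \<le> z" for y
    using that assms c d K_nonneg by simp
qed measurable

lemma wait_candidate:
  assumes "0 \<le> y" "y \<le> 1"
  shows "(\<integral>\<^sup>+ t. ennreal (exponential_density lam t)
      * ennreal (idle_cost S \<delta> y t + exp (- \<delta> * t) * obs_value (deplete S y t)) \<partial>lborel) = ennreal (candidate y)"
  by (rule nn_integral_exponential_wait[OF S \<delta> lam assms(1) candidate_deriv candidate_ode candidate_0])
    (use assms obs_value_nonneg in auto)

text \<open>
  The delay of a possible replenishment is integrated out: it is not revealed at the observation,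
  and its effect is by construction \<open>replenish_value\<close> of the observed state.
\<close>

lemma expected_stage:
  "(\<integral>\<^sup>+ w. ennreal (stage k w) \<partial>M) + (\<integral>\<^sup>+ w. ennreal (exp (- \<delta> * T (Suc k) w) * candidate (Y (Suc k) w)) \<partial>M)
   = (\<integral>\<^sup>+ w. ennreal (exp (- \<delta> * T k w) * (idle_cost S \<delta> (Y k w) (W (Suc k) w)
        + exp (- \<delta> * W (Suc k) w) * (if \<theta> (Suc k) w then replenish_value (Z (Suc k) w) else candidate (Z (Suc k) w)))) \<partial>M)"
proof -
  \<comment> \<open>A cycle ending at \<open>T (Suc k)\<close> costs \<open>H1\<close> while waiting for the observation; after it, \<open>a * q\<close> stands for
    a replenishment, including the later cost \<open>K\<close>, and \<open>H3\<close> for the later cost without one.\<close>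
  define a where "a w = exp (- \<delta> * Tobs (Suc k) w) * (if \<theta> (Suc k) w then 1 else 0)" for w
  define q where "q z t = idle_cost S \<delta> z t + exp (- \<delta> * t) * (c * (1 - deplete S z t) + d + K)" for z t
  define H1 where "H1 w = exp (- \<delta> * T k w) * idle_cost S \<delta> (Y k w) (W (Suc k) w)" for w
  define H3 where "H3 w = exp (- \<delta> * Tobs (Suc k) w) * (if \<theta> (Suc k) w then 0 else candidate (Z (Suc k) w))" for w
  have a_hist: "a \<in> borel_measurable (hist (seen k))"
    unfolding a_def using measurable_process(3,5)[of k] by measurable
  have [measurable]: "a \<in> borel_measurable M" by (rule measurable_from_hist[OF a_hist past_seen(5)])
  have [measurable]: "(\<lambda>(z, t). q z t) \<in> borel_measurable (borel \<Otimes>\<^sub>M borel)"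
    unfolding q_def by measurable
  have [measurable]: "H1 \<in> borel_measurable M" "H3 \<in> borel_measurable M"
    unfolding H1_def H3_def by measurable
  have stage_M: "(\<lambda>w. ennreal (stage k w)) \<in> borel_measurable M"
    unfolding stage_cost_def by measurable
  have "(\<integral>\<^sup>+ w. ennreal (a w) * ennreal (q (Z (Suc k) w) (om (Suc k) w)) \<partial>M)
      = (\<integral>\<^sup>+ w. (\<integral>\<^sup>+ t. ennreal (exponential_density mu t) * (ennreal (a w) * ennreal (q (Z (Suc k) w) t)) \<partial>lborel) \<partial>M)"
    using nn_integral_fresh_om[OF _ a_hist, of "\<lambda>p. ennreal (fst (fst p)) * ennreal (q (snd (fst p)) (snd p))"] by simp
  also have "\<dots> = (\<integral>\<^sup>+ w. ennreal (a w) * ennreal (replenish_value (Z (Suc k) w)) \<partial>M)"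
  proof (rule nn_integral_cong_AE)
    show "AE w in M. (\<integral>\<^sup>+ t. ennreal (exponential_density mu t) * (ennreal (a w) * ennreal (q (Z (Suc k) w) t)) \<partial>lborel)
        = ennreal (a w) * ennreal (replenish_value (Z (Suc k) w))"
      using AE_regular_path
    proof eventually_elim
      case (elim w)
      then have z: "0 \<le> Z (Suc k) w" "Z (Suc k) w \<le> 1" by auto
      have "(\<integral>\<^sup>+ t. ennreal (exponential_density mu t) * (ennreal (a w) * ennreal (q (Z (Suc k) w) t)) \<partial>lborel)
          = ennreal (a w) * (\<integral>\<^sup>+ t. ennreal (exponential_density mu t) * ennreal (q (Z (Suc k) w) t) \<partial>lborel)"
        by (subst nn_integral_cmult[symmetric]) (auto simp: mult_ac)
      also have "\<dots> = ennreal (a w) * ennreal (replenish_value (Z (Suc k) w))"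
        unfolding q_def using wait_replenish_value[OF z] by simp
      finally show ?case .
    qed
  qed
  finally have H2: "(\<integral>\<^sup>+ w. ennreal (a w) * ennreal (q (Z (Suc k) w) (om (Suc k) w)) \<partial>M)
      = (\<integral>\<^sup>+ w. ennreal (a w) * ennreal (replenish_value (Z (Suc k) w)) \<partial>M)" .
  have "(\<integral>\<^sup>+ w. ennreal (stage k w) \<partial>M) + (\<integral>\<^sup>+ w. ennreal (exp (- \<delta> * T (Suc k) w) * candidate (Y (Suc k) w)) \<partial>M)
      = (\<integral>\<^sup>+ w. ennreal (stage k w) + ennreal (exp (- \<delta> * T (Suc k) w) * candidate (Y (Suc k) w)) \<partial>M)"
    by (rule nn_integral_add[OF stage_M, symmetric]) measurable
  also have "\<dots> = (\<integral>\<^sup>+ w. ennreal (H1 w) + ennreal (a w) * ennreal (q (Z (Suc k) w) (om (Suc k) w)) + ennreal (H3 w) \<partial>M)"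
  proof (rule nn_integral_cong_AE)
    show "AE w in M. ennreal (stage k w) + ennreal (exp (- \<delta> * T (Suc k) w) * candidate (Y (Suc k) w))
        = ennreal (H1 w) + ennreal (a w) * ennreal (q (Z (Suc k) w) (om (Suc k) w)) + ennreal (H3 w)"
      using AE_regular_path
    proof eventually_elim
      case (elim w)
      then have "Z (Suc k) w \<in> {0..1}" "Y (Suc k) w \<in> {0..1}" and om: "om (Suc k) w > 0"
        by (blast, blast, simp)
      then have z: "0 \<le> Z (Suc k) w" "Z (Suc k) w \<le> 1" and y: "0 \<le> Y (Suc k) w" "Y (Suc k) w \<le> 1"
        by (simp_all only: atLeastAtMost_iff)
      have dep: "deplete S (Z (Suc k) w) (om (Suc k) w) \<le> 1"
        using deplete_bounds[of S "Z (Suc k) w" "om (Suc k) w"] S z om by simp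
      have Tobs: "exp (- \<delta> * Tobs (Suc k) w) = exp (- \<delta> * T k w) * exp (- \<delta> * W (Suc k) w)"
        unfolding Tobs_Suc by (simp add: mult_exp_exp algebra_simps)
      have T': "exp (- \<delta> * T (Suc k) w) = exp (- \<delta> * Tobs (Suc k) w) * (if \<theta> (Suc k) w then exp (- \<delta> * om (Suc k) w) else 1)"
        unfolding T_Suc by (simp add: mult_exp_exp algebra_simps del: obs_time.simps)
      have Y': "\<not> \<theta> (Suc k) w \<Longrightarrow> Y (Suc k) w = Z (Suc k) w" "\<theta> (Suc k) w \<Longrightarrow> Y (Suc k) w = 1"
        by (simp_all add: Z_Suc exec_delay_def)
      have nonneg: "stage k w \<ge> 0" "exp (- \<delta> * T (Suc k) w) * candidate (Y (Suc k) w) \<ge> 0" "H1 w \<ge> 0" "a w \<ge> 0" "H3 w \<ge> 0"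
        "q (Z (Suc k) w) (om (Suc k) w) \<ge> 0"
        using candidate_nonneg[OF y] candidate_nonneg[OF z] dep \<delta> c d K_nonneg
        by (simp_all add: stage_cost_def H1_def H3_def a_def q_def idle_cost_nonneg)
      have split: "stage k w + exp (- \<delta> * T (Suc k) w) * candidate (Y (Suc k) w)
          = H1 w + a w * q (Z (Suc k) w) (om (Suc k) w) + H3 w"
        unfolding T' H1_def H3_def a_def q_def stage_cost_def Tobs
        by (cases "\<theta> (Suc k) w") (simp_all add: Y' candidate_1 algebra_simps del: post_state.simps)
      show ?case
        unfolding ennreal_plus[OF nonneg(1,2), symmetric] split
        by (simp only: ennreal_plus ennreal_mult mult_nonneg_nonneg add_nonneg_nonneg nonneg)
    qed
  qed
  also have "\<dots> = (\<integral>\<^sup>+ w. ennreal (H1 w) \<partial>M) + (\<integral>\<^sup>+ w. ennreal (a w) * ennreal (replenish_value (Z (Suc k) w)) \<partial>M)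
      + (\<integral>\<^sup>+ w. ennreal (H3 w) \<partial>M)"
    unfolding H2[symmetric] by (intro nn_integral_add3) measurable
  also have "\<dots> = (\<integral>\<^sup>+ w. ennreal (H1 w) + ennreal (a w) * ennreal (replenish_value (Z (Suc k) w)) + ennreal (H3 w) \<partial>M)"
    by (intro nn_integral_add3[symmetric]) measurable
  also have "\<dots> = (\<integral>\<^sup>+ w. ennreal (exp (- \<delta> * T k w) * (idle_cost S \<delta> (Y k w) (W (Suc k) w)
        + exp (- \<delta> * W (Suc k) w) * (if \<theta> (Suc k) w then replenish_value (Z (Suc k) w) else candidate (Z (Suc k) w)))) \<partial>M)"
  proof (rule nn_integral_cong_AE)
    show "AE w in M. ennreal (H1 w) + ennreal (a w) * ennreal (replenish_value (Z (Suc k) w)) + ennreal (H3 w)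
        = ennreal (exp (- \<delta> * T k w) * (idle_cost S \<delta> (Y k w) (W (Suc k) w)
        + exp (- \<delta> * W (Suc k) w) * (if \<theta> (Suc k) w then replenish_value (Z (Suc k) w) else candidate (Z (Suc k) w))))"
      using AE_regular_path
    proof eventually_elim
      case (elim w)
      then have z: "0 \<le> Z (Suc k) w" "Z (Suc k) w \<le> 1" by auto
      have Tobs: "exp (- \<delta> * Tobs (Suc k) w) = exp (- \<delta> * T k w) * exp (- \<delta> * W (Suc k) w)"
        unfolding Tobs_Suc by (simp add: mult_exp_exp algebra_simps)
      have nonneg: "H1 w \<ge> 0" "a w \<ge> 0" "H3 w \<ge> 0" "replenish_value (Z (Suc k) w) \<ge> 0"
        using candidate_nonneg[OF z] replenish_value_nonneg[OF z(2)] \<delta> by (simp_all add: H1_def H3_def a_def idle_cost_nonneg)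
      have merge: "H1 w + a w * replenish_value (Z (Suc k) w) + H3 w = exp (- \<delta> * T k w) * (idle_cost S \<delta> (Y k w) (W (Suc k) w)
        + exp (- \<delta> * W (Suc k) w) * (if \<theta> (Suc k) w then replenish_value (Z (Suc k) w) else candidate (Z (Suc k) w)))"
        unfolding H1_def H3_def a_def Tobs by (simp add: algebra_simps)
      show ?case
        unfolding merge[symmetric]
        by (simp only: ennreal_plus ennreal_mult mult_nonneg_nonneg add_nonneg_nonneg nonneg)
    qed
  qed
  finally show ?thesis .
qed

text \<open>
  The waiting time is integrated out: this is the dynamic programming equation of the candidate, in
  discounted form.
\<close>

lemma expected_obs_value:
  "(\<integral>\<^sup>+ w. ennreal (exp (- \<delta> * T k w) * (idle_cost S \<delta> (Y k w) (W (Suc k) w)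
        + exp (- \<delta> * W (Suc k) w) * obs_value (Z (Suc k) w))) \<partial>M)
   = (\<integral>\<^sup>+ w. ennreal (exp (- \<delta> * T k w) * candidate (Y k w)) \<partial>M)"
proof -
  define q where "q y t = idle_cost S \<delta> y t + exp (- \<delta> * t) * obs_value (deplete S y t)" for y t
  have [measurable]: "(\<lambda>(z, t). q z t) \<in> borel_measurable (borel \<Otimes>\<^sub>M borel)"
    unfolding q_def by measurable
  have "(\<integral>\<^sup>+ w. ennreal (exp (- \<delta> * T k w) * (idle_cost S \<delta> (Y k w) (W (Suc k) w)
        + exp (- \<delta> * W (Suc k) w) * obs_value (Z (Suc k) w))) \<partial>M)
      = (\<integral>\<^sup>+ w. ennreal (exp (- \<delta> * T k w)) * ennreal (q (Y k w) (W (Suc k) w)) \<partial>M)"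
    unfolding q_def Z_Suc by (simp add: ennreal_mult')
  also have "\<dots> = (\<integral>\<^sup>+ w. (\<integral>\<^sup>+ t. ennreal (exponential_density lam t)
      * (ennreal (exp (- \<delta> * T k w)) * ennreal (q (Y k w) t)) \<partial>lborel) \<partial>M)"
    using nn_integral_fresh_W[of "\<lambda>p. ennreal (exp (- \<delta> * fst (fst p))) * ennreal (q (snd (fst p)) (snd p))"] by simp
  also have "\<dots> = (\<integral>\<^sup>+ w. ennreal (exp (- \<delta> * T k w) * candidate (Y k w)) \<partial>M)"
  proof (rule nn_integral_cong_AE)
    show "AE w in M. (\<integral>\<^sup>+ t. ennreal (exponential_density lam t)
        * (ennreal (exp (- \<delta> * T k w)) * ennreal (q (Y k w) t)) \<partial>lborel) = ennreal (exp (- \<delta> * T k w) * candidate (Y k w))"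
      using AE_regular_path
    proof eventually_elim
      case (elim w)
      then have y: "0 \<le> Y k w" "Y k w \<le> 1" by auto
      have "(\<integral>\<^sup>+ t. ennreal (exponential_density lam t) * (ennreal (exp (- \<delta> * T k w)) * ennreal (q (Y k w) t)) \<partial>lborel)
          = ennreal (exp (- \<delta> * T k w)) * (\<integral>\<^sup>+ t. ennreal (exponential_density lam t) * ennreal (q (Y k w) t) \<partial>lborel)"
        by (subst nn_integral_cmult[symmetric]) (auto simp: mult_ac)
      also have "\<dots> = ennreal (exp (- \<delta> * T k w) * candidate (Y k w))"
        unfolding q_def wait_candidate[OF y] by (simp add: ennreal_mult')
      finally show ?case .
    qed
  qed
  finally show ?thesis .
qed

text \<open>
  Whatever is decided at the observation costs at least \<open>obs_value\<close>.
\<close>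

lemma expected_candidate_le:
  "(\<integral>\<^sup>+ w. ennreal (exp (- \<delta> * T k w) * candidate (Y k w)) \<partial>M)
    \<le> (\<integral>\<^sup>+ w. ennreal (stage k w) \<partial>M) + (\<integral>\<^sup>+ w. ennreal (exp (- \<delta> * T (Suc k) w) * candidate (Y (Suc k) w)) \<partial>M)"
  unfolding expected_stage
  unfolding expected_obs_value[symmetric]
proof (rule nn_integral_mono_AE, use AE_regular_path in eventually_elim)
  case (elim w)
  then have z: "0 \<le> Z (Suc k) w" "Z (Suc k) w \<le> 1" by auto
  show ?case
    using obs_value_le[OF z] by (intro ennreal_leI mult_left_mono add_left_mono) auto
qed

text \<open>
  The threshold control takes the option that defines \<open>obs_value\<close>.
\<close>

lemma expected_candidate_eq:
  assumes "threshold_control M S W om xbar x \<theta>"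
  shows "(\<integral>\<^sup>+ w. ennreal (exp (- \<delta> * T k w) * candidate (Y k w)) \<partial>M)
    = (\<integral>\<^sup>+ w. ennreal (stage k w) \<partial>M) + (\<integral>\<^sup>+ w. ennreal (exp (- \<delta> * T (Suc k) w) * candidate (Y (Suc k) w)) \<partial>M)"
  unfolding expected_stage
  unfolding expected_obs_value[symmetric]
proof (rule nn_integral_cong)
  fix w assume "w \<in> space M"
  then have "\<theta> (Suc k) w \<longleftrightarrow> Z (Suc k) w \<le> xbar"
    using assms by (simp add: threshold_control_def)
  then show "ennreal (exp (- \<delta> * T k w) * (idle_cost S \<delta> (Y k w) (W (Suc k) w)
        + exp (- \<delta> * W (Suc k) w) * obs_value (Z (Suc k) w)))
    = ennreal (exp (- \<delta> * T k w) * (idle_cost S \<delta> (Y k w) (W (Suc k) w)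
        + exp (- \<delta> * W (Suc k) w) * (if \<theta> (Suc k) w then replenish_value (Z (Suc k) w) else candidate (Z (Suc k) w))))"
    by (simp add: obs_value_def)
qed

lemma expected_candidate_0: "(\<integral>\<^sup>+ w. ennreal (exp (- \<delta> * T 0 w) * candidate (Y 0 w)) \<partial>M) = ennreal (candidate x)"
proof -
  have "(\<integral>\<^sup>+ w. ennreal (exp (- \<delta> * T 0 w) * candidate (Y 0 w)) \<partial>M) = (\<integral>\<^sup>+ w. ennreal (candidate x) \<partial>M)"
    by (intro nn_integral_cong) (simp add: exec_time_def exec_delay_def theta_0)
  then show ?thesis by (simp add: emeasure_space_1)
qed

lemma expected_candidate_vanishes: "(\<lambda>k. \<integral>\<^sup>+ w. ennreal (exp (- \<delta> * T k w) * candidate (Y k w)) \<partial>M) \<longlonglongrightarrow> 0"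
proof -
  obtain b where b: "\<And>y. y \<in> {0..1} \<Longrightarrow> candidate y \<le> b" using candidate_bounded by blast
  have b0: "b \<ge> 0" using b[of 0] candidate_nonneg[of 0] by simp
  define q where "q = lam / (\<delta> + lam)"
  have q: "0 \<le> q" "q < 1" using lam \<delta> by (auto simp: q_def)
  have le: "(\<integral>\<^sup>+ w. ennreal (exp (- \<delta> * T k w) * candidate (Y k w)) \<partial>M) \<le> ennreal (q ^ k * b)" for k
  proof -
    have "(\<integral>\<^sup>+ w. ennreal (exp (- \<delta> * T k w) * candidate (Y k w)) \<partial>M)
        \<le> (\<integral>\<^sup>+ w. ennreal (exp (- \<delta> * T k w)) * ennreal b \<partial>M)"
    proof (rule nn_integral_mono_AE, use AE_regular_path in eventually_elim)
      case (elim w)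
      then have "candidate (Y k w) \<le> b" using b by blast
      then show ?case
        unfolding ennreal_mult[OF exp_ge_zero b0, symmetric]
        by (intro ennreal_leI mult_left_mono) simp_all
    qed
    also have "\<dots> = (\<integral>\<^sup>+ w. ennreal (exp (- \<delta> * T k w)) \<partial>M) * ennreal b"
      by (rule nn_integral_multc) measurable
    also have "\<dots> \<le> ennreal (q ^ k) * ennreal b"
      unfolding q_def by (intro mult_right_mono expected_discount_le \<delta>) simp
    finally show ?thesis using q by (simp add: ennreal_mult')
  qed
  have "(\<lambda>k. ennreal (q ^ k * b)) \<longlonglongrightarrow> ennreal (0 * b)"
    by (intro tendsto_ennrealI tendsto_mult_right LIMSEQ_realpow_zero q)
  then have "(\<lambda>k. ennreal (q ^ k * b)) \<longlonglongrightarrow> 0" by simp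
  then show ?thesis
    by (rule tendsto_sandwich[OF _ _ tendsto_const, rotated 2]) (simp_all only: le zero_le eventually_True)
qed

lemma performance_eq_sum:
  "performance M S \<delta> c d W om x \<theta> = enn2ereal (\<Sum>k. \<integral>\<^sup>+ w. ennreal (stage k w) \<partial>M)"
proof -
  have stage_M: "(\<lambda>w. ennreal (stage k w)) \<in> borel_measurable M" for k
    unfolding stage_cost_def by measurable
  have "(\<integral>\<^sup>+ w. path_cost S \<delta> c d x (\<lambda>i. W i w) (\<lambda>i. om i w) (\<lambda>i. \<theta> i w) \<partial>M)
      = (\<integral>\<^sup>+ w. (\<Sum>k. ennreal (stage k w)) \<partial>M)"
  proof (rule nn_integral_cong_AE, use AE_regular_path in eventually_elim)
    case (elim w)
    note pos = elim[THEN conjunct2, THEN conjunct1]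
      and unbounded = elim[THEN conjunct2, THEN conjunct2, THEN conjunct1]
    show ?case
      by (rule path_cost_eq_sum_stage_cost[OF S \<delta> c d x01])
        (simp_all only: pos unbounded theta_0[OF elim[THEN conjunct1]] not_False_eq_True)
  qed
  also have "\<dots> = (\<Sum>k. \<integral>\<^sup>+ w. ennreal (stage k w) \<partial>M)"
    by (rule nn_integral_suminf[OF stage_M])
  finally show ?thesis by (simp add: performance_def)
qed

text \<open>
  The quantity on the left is nondecreasing in \<open>n\<close> for every admissible control and constant for the
  threshold control, which gives the two theorems that follow.
\<close>

lemma partial_sums_limit:
  "(\<lambda>n. (\<Sum>k<n. \<integral>\<^sup>+ w. ennreal (stage k w) \<partial>M) + (\<integral>\<^sup>+ w. ennreal (exp (- \<delta> * T n w) * candidate (Y n w)) \<partial>M))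
    \<longlonglongrightarrow> (\<Sum>k. \<integral>\<^sup>+ w. ennreal (stage k w) \<partial>M)"
proof -
  have "(\<lambda>n. \<Sum>k<n. \<integral>\<^sup>+ w. ennreal (stage k w) \<partial>M) \<longlonglongrightarrow> (\<Sum>k. \<integral>\<^sup>+ w. ennreal (stage k w) \<partial>M)"
    by (rule summable_LIMSEQ[OF summableI])
  from tendsto_add[OF this expected_candidate_vanishes] show ?thesis by (simp only: add_0_right)
qed

lemma performance_ge: "ereal (candidate x) \<le> performance M S \<delta> c d W om x \<theta>"
proof -
  have "ennreal (candidate x) \<le> (\<Sum>k<n. \<integral>\<^sup>+ w. ennreal (stage k w) \<partial>M) + (\<integral>\<^sup>+ w. ennreal (exp (- \<delta> * T n w) * candidate (Y n w)) \<partial>M)" for n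
  proof (induction n)
    case 0
    then show ?case using expected_candidate_0 by simp
  next
    case (Suc n)
    note Suc
    also have "(\<Sum>k<n. \<integral>\<^sup>+ w. ennreal (stage k w) \<partial>M) + (\<integral>\<^sup>+ w. ennreal (exp (- \<delta> * T n w) * candidate (Y n w)) \<partial>M)
        \<le> (\<Sum>k<n. \<integral>\<^sup>+ w. ennreal (stage k w) \<partial>M) + ((\<integral>\<^sup>+ w. ennreal (stage n w) \<partial>M)
          + (\<integral>\<^sup>+ w. ennreal (exp (- \<delta> * T (Suc n) w) * candidate (Y (Suc n) w)) \<partial>M))"
      by (intro add_left_mono expected_candidate_le)
    finally show ?case by (simp only: sum.lessThan_Suc add.assoc)
  qed
  then have "ennreal (candidate x) \<le> (\<Sum>k. \<integral>\<^sup>+ w. ennreal (stage k w) \<partial>M)"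
    by (intro LIMSEQ_le_const[OF partial_sums_limit]) blast
  then have "enn2ereal (ennreal (candidate x)) \<le> performance M S \<delta> c d W om x \<theta>"
    unfolding performance_eq_sum by (simp add: less_eq_ennreal.rep_eq)
  then show ?thesis using candidate_nonneg x01 by (simp add: enn2ereal_ennreal)
qed

lemma performance_threshold:
  assumes "threshold_control M S W om xbar x \<theta>"
  shows "performance M S \<delta> c d W om x \<theta> = ereal (candidate x)"
proof -
  have "(\<Sum>k<n. \<integral>\<^sup>+ w. ennreal (stage k w) \<partial>M) + (\<integral>\<^sup>+ w. ennreal (exp (- \<delta> * T n w) * candidate (Y n w)) \<partial>M) = ennreal (candidate x)" for n
  proof (induction n)
    case 0
    then show ?case using expected_candidate_0 by simp
  next
    case (Suc n)
    then show ?case using expected_candidate_eq[OF assms, of n] by (simp only: sum.lessThan_Suc add.assoc)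
  qed
  then have "(\<lambda>_ :: nat. ennreal (candidate x)) \<longlonglongrightarrow> (\<Sum>k. \<integral>\<^sup>+ w. ennreal (stage k w) \<partial>M)"
    using partial_sums_limit by (simp only:)
  then have "(\<Sum>k. \<integral>\<^sup>+ w. ennreal (stage k w) \<partial>M) = ennreal (candidate x)"
    using LIMSEQ_unique tendsto_const by blast
  then show ?thesis
    unfolding performance_eq_sum using candidate_nonneg x01 by (simp add: enn2ereal_ennreal)
qed

end

section \<open>Threshold controls\<close>

text \<open>
  The defining condition of a threshold control refers to the decision sequence itself, but only to
  its earlier members; running the state forward with the rule built in resolves the recursion.
\<close>

lemma threshold_control_exists: "\<exists>\<theta>. threshold_control M S W om xbar x \<theta>"
proof -
  \<comment> \<open>The state after each execution time under the threshold rule.\<close>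
  define y where "y w = rec_nat x (\<lambda>k y. let z = deplete S y (W (Suc k) w) in if z \<le> xbar then 1 else z)" for w
  define \<theta> where "\<theta> k w = (case k of 0 \<Rightarrow> False | Suc j \<Rightarrow> deplete S (y w j) (W k w) \<le> xbar)" for k w
  have post: "post_state S x (\<lambda>i. W i w) (\<lambda>i. om i w) (\<lambda>i. \<theta> i w) k = y w k" for k w
    by (induction k) (simp_all add: y_def \<theta>_def exec_delay_def Let_def)
  have "\<theta> k w \<longleftrightarrow> obs_state S x (\<lambda>i. W i w) (\<lambda>i. om i w) (\<lambda>i. \<theta> i w) k \<le> xbar" if "k \<ge> 1" for k w
  proof -
    obtain j where k: "k = Suc j" using \<open>k \<ge> 1\<close> by (metis One_nat_def Suc_le_D)
    show ?thesis unfolding k obs_state_def nat.case post by (simp add: \<theta>_def)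
  qed
  moreover have "\<not> \<theta> 0 w" for w by (simp add: \<theta>_def)
  ultimately have "threshold_control M S W om xbar x \<theta>"
    unfolding threshold_control_def by blast
  then show ?thesis by blast
qed

text \<open>
  The rule reads off the observed state, which generates part of the current \<open>info\<close>.
\<close>

lemma threshold_control_admissible:
  assumes "threshold_control M S W om xbar x \<theta>"
  shows "\<theta> \<in> admissible M S W om x"
proof -
  have "\<theta> k \<in> info M S W om x \<theta> k \<rightarrow>\<^sub>M count_space UNIV" if "k \<ge> 1" for k
  proof -
    let ?obs = "\<lambda>w. (obs_time (\<lambda>i. W i w) (\<lambda>i. om i w) (\<lambda>i. \<theta> i w) k,
                        obs_state S x (\<lambda>i. W i w) (\<lambda>i. om i w) (\<lambda>i. \<theta> i w) k)"
    have space: "space (info M S W om x \<theta> k) = space M"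
      unfolding info_def Let_def by (rule space_measure_of) auto
    have "UNIV \<times> {..xbar} \<in> sets (borel :: (real \<times> real) measure)"
      unfolding borel_prod[symmetric] by (intro pair_measureI) auto
    then have "?obs -` (UNIV \<times> {..xbar}) \<inter> space M \<in> sets (info M S W om x \<theta> k)"
      unfolding info_def Let_def by (subst sets_measure_of) (auto intro!: sigma_sets.Basic)
    moreover have "{w \<in> space M. \<theta> k w} = ?obs -` (UNIV \<times> {..xbar}) \<inter> space M"
      using assms that by (auto simp: threshold_control_def)
    ultimately show ?thesis by (simp add: pred_def space)
  qed
  then show ?thesis using assms by (simp add: admissible_def threshold_control_def)
qed

theorem proposition1:
  fixes M :: "'w measure" and W om :: "nat \<Rightarrow> 'w \<Rightarrow> real"
    and S \<delta> c d lam mu \<alpha> \<beta> \<gamma> B C G K xbar :: real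
    and A :: "real \<Rightarrow> real" and Phibar :: "real \<Rightarrow> real"
  assumes "S > 0" "\<delta> > 0" "c > 0" "d > 0" "lam > 0" "mu > lam"
    and "exponential_times M lam mu W om"
    and "\<alpha> = mu / (\<delta> + mu) * (c + d + c * S / (\<delta> + mu))"
    and "\<beta> = mu / (\<delta> + mu)"
    and "\<gamma> = 1 / (\<delta> + mu) - mu * c * S / (\<delta> + mu)\<^sup>2"
    and "\<And>k. A k = lam * \<alpha> / (\<delta> + lam) + lam * c * S * \<beta> / (\<delta> + lam)\<^sup>2
                      + lam * \<beta> * k / (\<delta> + lam)"
    and "B = - (lam * c * \<beta> / (\<delta> + lam))"
    and "C = - (lam / (mu - lam) * \<gamma>)"
    and "G = 1 / (\<delta> + lam) * (1 - lam * c * S * \<beta> / (\<delta> + lam)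
                + lam * (\<delta> + mu) * \<gamma> / (mu - lam))"
    and unique_solution:
      "{(k, y). 0 < y \<and> y < 1
          \<and> G * exp (- (\<delta> + lam) / S * y) + A k + B * y + C * exp (- (\<delta> + mu) / S * y)
              = k * exp (\<delta> / S * (1 - y))
          \<and> - (\<delta> + lam) / S * G * exp (- (\<delta> + lam) / S * y) + B
                - (\<delta> + mu) / S * C * exp (- (\<delta> + mu) / S * y)
              = - \<delta> / S * k * exp (\<delta> / S * (1 - y))} = {(K, xbar)}"
    and "\<And>x. Phibar x =
           (if x \<le> xbar
            then G * exp (- (\<delta> + lam) / S * x) + A K + B * x + C * exp (- (\<delta> + mu) / S * x)
            else K * exp (\<delta> / S * (1 - x)))"
  shows "(\<forall>x\<in>{0..1}. value_function M S \<delta> c d W om x \<ge> ereal (Phibar x))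
    \<and> (\<forall>x\<in>{0..1}. \<exists>\<theta>. threshold_control M S W om xbar x \<theta>)
    \<and> (\<forall>x\<in>{0..1}. \<forall>\<theta>. threshold_control M S W om xbar x \<theta> \<longrightarrow>
          is_arg_min (performance M S \<delta> c d W om x) (\<lambda>\<theta>'. \<theta>' \<in> admissible M S W om x) \<theta>
          \<and> performance M S \<delta> c d W om x \<theta> = ereal (Phibar x)
          \<and> value_function M S \<delta> c d W om x = ereal (Phibar x))"
proof -
  have "(K, xbar) \<in> {(k, y). 0 < y \<and> y < 1
          \<and> G * exp (- (\<delta> + lam) / S * y) + A k + B * y + C * exp (- (\<delta> + mu) / S * y)
              = k * exp (\<delta> / S * (1 - y))
          \<and> - (\<delta> + lam) / S * G * exp (- (\<delta> + lam) / S * y) + B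
                - (\<delta> + mu) / S * C * exp (- (\<delta> + mu) / S * y)
              = - \<delta> / S * k * exp (\<delta> / S * (1 - y))}"
    unfolding unique_solution by (rule singletonI)
  then have solution: "0 < xbar" "xbar < 1"
    "G * exp (- (\<delta> + lam) / S * xbar) + A K + B * xbar + C * exp (- (\<delta> + mu) / S * xbar)
       = K * exp (\<delta> / S * (1 - xbar))"
    "- (\<delta> + lam) / S * G * exp (- (\<delta> + lam) / S * xbar) + B
       - (\<delta> + mu) / S * C * exp (- (\<delta> + mu) / S * xbar)
       = - \<delta> / S * K * exp (\<delta> / S * (1 - xbar))"
    by (simp_all only: mem_Collect_eq prod.case)
  have fb: "free_boundary S \<delta> c d lam mu \<alpha> \<beta> \<gamma> B C G K xbar (A K)"
    by (rule free_boundary.intro) (fact assms solution)+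
  have candidate: "free_boundary.candidate S \<delta> lam mu B C G K xbar (A K) y = Phibar y" for y
    using assms(16)
    by (simp only: free_boundary.candidate_def[OF fb] free_boundary.lower_def[OF fb] free_boundary.upper_def[OF fb])
  have "mu > 0" using assms(5,6) by simp
  have verification: "verification M W om S \<delta> c d lam mu \<alpha> \<beta> \<gamma> B C G K xbar (A K) x \<theta>"
    if "x \<in> {0..1}" "\<theta> \<in> admissible M S W om x" for x \<theta>
    by (intro verification.intro fb controlled_process.intro exponential_clock.intro
        controlled_process_axioms.intro that) (fact assms \<open>mu > 0\<close>)+
  note lower_bound = verification.performance_ge[OF verification, unfolded candidate]
    and attained = verification.performance_threshold[OF verification, unfolded candidate]
  have value_ge: "value_function M S \<delta> c d W om x \<ge> ereal (Phibar x)" if "x \<in> {0..1}" for x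
    unfolding value_function_def by (intro INF_greatest lower_bound that)
  have threshold_optimal: "is_arg_min (performance M S \<delta> c d W om x) (\<lambda>\<theta>'. \<theta>' \<in> admissible M S W om x) \<theta>
      \<and> performance M S \<delta> c d W om x \<theta> = ereal (Phibar x)
      \<and> value_function M S \<delta> c d W om x = ereal (Phibar x)"
    if x: "x \<in> {0..1}" and \<theta>: "threshold_control M S W om xbar x \<theta>" for x \<theta>
  proof -
    have adm: "\<theta> \<in> admissible M S W om x" by (rule threshold_control_admissible[OF \<theta>])
    have cost: "performance M S \<delta> c d W om x \<theta> = ereal (Phibar x)" by (rule attained[OF x adm \<theta>])
    have "value_function M S \<delta> c d W om x \<le> ereal (Phibar x)"
      unfolding value_function_def cost[symmetric] by (rule INF_lower[OF adm])
    then have "value_function M S \<delta> c d W om x = ereal (Phibar x)"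
      using value_ge[OF x] by (rule antisym)
    moreover have "\<not> performance M S \<delta> c d W om x \<theta>' < performance M S \<delta> c d W om x \<theta>"
      if "\<theta>' \<in> admissible M S W om x" for \<theta>'
      using lower_bound[OF x that] cost by (simp add: not_less)
    ultimately show ?thesis using adm cost by (auto simp: is_arg_min_def)
  qed
  show ?thesis
    using value_ge threshold_control_exists threshold_optimal by blast
qed

end
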